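(* Let $y_1,\dots,y_m\in\mathbb{R}^n$ satisfy $Id=\sum_{i\leq m}y_iy_i^t$, and let $T$ be a nonzero linear operator on $\ell_2^n$. For any $\varepsilon\in(0,1)$ there exists $\sigma\subset\{1,\dots,m\}$, consisting of indices $j$ with $Ty_j\ne 0$, such that $$|\sigma|\geq(1-\varepsilon)^2\,\frac{\|T\|_{\rm HS}^2}{\|T\|^2}$$ and for all real $(a_j)_{j\in\sigma}$, $$\frac{\varepsilon}{2-\varepsilon}\Big(\sum_{j\in\sigma}a_j^2\Big)^{1/2}\leq\Big\|\sum_{j\in\sigma}a_j\frac{Ty_j}{\|Ty_j\|_2}\Big\|_2\leq\frac{2-\varepsilon}{\varepsilon}\Big(\sum_{j\in\sigma}a_j^2\Big)^{1/2}.$$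
   Context: $Id$ is the identity of $\mathbb{R}^n$; $\ell_2^n$ is $\mathbb{R}^n$ with the Euclidean norm $\|\cdot\|_2$. $\|T\|_{\rm HS}^2={\rm Tr}(TT^t)$ is the squared Hilbert-Schmidt norm and $\|T\|$ is the operator norm of $T$ on $\ell_2^n$. *)

theory Defs
  imports "HOL-Analysis.Analysis"
begin

definition outer_square :: "real ^ 'n \<Rightarrow> real ^ 'n ^ 'n" where
  "outer_square y = (columnvector y :: real ^ 1 ^ 'n) ** (rowvector y :: real ^ 'n ^ 1)"

definition hs_norm :: "(real ^ 'n \<Rightarrow> real ^ 'n) \<Rightarrow> real" where
  "hs_norm T = sqrt (trace (matrix T ** transpose (matrix T)))"

end

theory Submission
  imports Defs
begin

text \<open>
The vectors \<open>x\<^sub>j = T y\<^sub>j / \<parallel>T\<parallel>\<close> form a Bessel family, \<open>\<Sum> \<langle>x\<^sub>j, z\<rangle>\<^sup>2 \<le> \<parallel>z\<parallel>\<^sup>2\<close>, with total energy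
\<open>h = \<Sum> \<parallel>x\<^sub>j\<parallel>\<^sup>2 = \<parallel>T\<parallel>\<^sub>H\<^sub>S\<^sup>2 / \<parallel>T\<parallel>\<^sup>2\<close>. It suffices to find at least \<open>(1 - \<epsilon>)\<^sup>2 h\<close> indices and positive
weights \<open>r\<^sub>j\<close> such that the Gram matrix of the vectors \<open>w\<^sub>j = r\<^sub>j x\<^sub>j\<close> has its spectrum in
\<open>[\<epsilon>\<^sup>2 h, (2 - \<epsilon>)\<^sup>2 h]\<close>. The diagonal entries \<open>\<parallel>w\<^sub>j\<parallel>\<^sup>2\<close> then lie in the same interval, so that
normalising the vectors costs at most the ratio of the two endpoints, and this ratio is
the square of the claimed constant \<open>(2 - \<epsilon>) / \<epsilon>\<close>. Since \<open>r\<^sub>j > 0\<close>, the normalised vectors do not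
depend on the weights.

The indices are found one at a time by the barrier method of Batson, Spielman and
Srivastava, used with two barriers simultaneously. Let \<open>A\<close> be the frame operator of the
weighted vectors chosen so far. A lower barrier \<open>l\<close> stays below the nonzero eigenvalues of \<open>A\<close>
and moves down, an upper barrier \<open>u\<close> stays above all eigenvalues and moves up. The distance of
the spectrum from a barrier \<open>c\<close> is measured by the potential \<open>\<Sum> \<langle>x\<^sub>i, (A - c)\<inverse> x\<^sub>i\<rangle>\<close>.
By the Sherman-Morrison formula, adding \<open>x\<^sub>j\<close> with squared weight \<open>1 / t\<close> keeps both potentials
under control as soon as \<open>U\<^sub>j < t < L\<^sub>j\<close>, where \<open>U\<^sub>j\<close> and \<open>L\<^sub>j\<close> depend on \<open>A\<close> and the barriers.
The sums of the \<open>U\<^sub>j\<close> and of the \<open>L\<^sub>j\<close> over all indices are bounded through the potentials and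
the step sizes, which are chosen such that \<open>\<Sum> U\<^sub>j < \<Sum> L\<^sub>j\<close>; hence a suitable \<open>j\<close> exists
(\<open>barrier_step\<close>). The lower sum is the delicate one, because \<open>A\<close> has a kernel, on which
\<open>(A - l)\<inverse>\<close> is negative; its contribution is absorbed since the kernel still carries
a large part of the energy (\<open>lower_potential_drop\<close>).

Moving barriers are affordable as long as fewer than \<open>(1 - \<epsilon>)\<^sup>2 h\<close> vectors are selected after
the step. One more vector can be added with both barriers at rest (\<open>last_step\<close>),
and this brings the number of vectors to at least \<open>(1 - \<epsilon>)\<^sup>2 h\<close> without any rounding loss.
\<close>

section \<open>Frame operators and resolvents\<close>

definition frame_op :: "'i set \<Rightarrow> ('i \<Rightarrow> 'a::euclidean_space) \<Rightarrow> 'a \<Rightarrow> 'a" where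
  "frame_op \<sigma> w z = (\<Sum>j\<in>\<sigma>. (w j \<bullet> z) *\<^sub>R w j)"

definition resolvent :: "('a::euclidean_space \<Rightarrow> 'a) \<Rightarrow> real \<Rightarrow> 'a \<Rightarrow> 'a" where
  "resolvent A c = inv (\<lambda>z. A z - c *\<^sub>R z)"

lemma linear_frame_op: "linear (frame_op \<sigma> w)"
  by (rule linearI)
    (simp_all add: frame_op_def inner_add_right scaleR_add_left sum.distrib scaleR_sum_right)

lemma frame_op_self_adjoint: "frame_op \<sigma> w z \<bullet> z' = z \<bullet> frame_op \<sigma> w z'"
  by (simp add: frame_op_def inner_sum_left inner_sum_right inner_commute mult.commute)

lemma inner_frame_op: "z \<bullet> frame_op \<sigma> w z = (\<Sum>j\<in>\<sigma>. (w j \<bullet> z)\<^sup>2)"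
  by (simp add: frame_op_def inner_sum_right inner_commute power2_eq_square)

lemma frame_op_insert:
  assumes "finite \<sigma>" "j \<notin> \<sigma>"
  shows "frame_op (insert j \<sigma>) (w(j := v)) z = frame_op \<sigma> w z + (v \<bullet> z) *\<^sub>R v"
proof -
  have "(\<Sum>i\<in>\<sigma>. ((w(j := v)) i \<bullet> z) *\<^sub>R (w(j := v)) i) = (\<Sum>i\<in>\<sigma>. (w i \<bullet> z) *\<^sub>R w i)"
    using assms by (intro sum.cong) auto
  then show ?thesis
    using assms by (simp add: frame_op_def add.commute)
qed

text \<open>
For self-adjoint \<open>A\<close> in finite dimension, \<open>A - c\<close> is invertible as soon as \<open>c\<close> has no
eigenvector; under this condition \<open>resolvent A c\<close> is \<open>(A - c)\<inverse>\<close>.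
\<close>

locale regular_value =
  fixes A :: "'a::euclidean_space \<Rightarrow> 'a" and c :: real
  assumes lin: "linear A"
    and self_adjoint: "\<And>z z'. A z \<bullet> z' = z \<bullet> A z'"
    and no_eigenvector: "\<And>z. A z = c *\<^sub>R z \<Longrightarrow> z = 0"
begin

lemma linear_shift: "linear (\<lambda>z. A z - c *\<^sub>R z)"
  by (intro linear_compose_sub lin linear_compose_scale_right linear_ident)

lemma inj_shift: "inj (\<lambda>z. A z - c *\<^sub>R z)"
  unfolding linear_injective_0[OF linear_shift] using no_eigenvector by simp

lemma surj_shift: "surj (\<lambda>z. A z - c *\<^sub>R z)"
  by (rule linear_inj_imp_surj[OF linear_shift inj_shift])

lemma resolvent_right: "A (resolvent A c z) - c *\<^sub>R resolvent A c z = z"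
  using surj_f_inv_f[OF surj_shift] by (simp add: resolvent_def)

lemma resolvent_eqI: "A y - c *\<^sub>R y = z \<Longrightarrow> resolvent A c z = y"
  using inv_f_f[OF inj_shift, of y] by (simp add: resolvent_def)

lemma linear_resolvent: "linear (resolvent A c)"
proof (rule linearI)
  show "resolvent A c (a + b) = resolvent A c a + resolvent A c b" for a b
    by (rule resolvent_eqI)
      (use resolvent_right[of a] resolvent_right[of b] in \<open>simp add: linear_add[OF lin] algebra_simps\<close>)
  show "resolvent A c (r *\<^sub>R b) = r *\<^sub>R resolvent A c b" for r b
  proof (rule resolvent_eqI)
    have "A (r *\<^sub>R resolvent A c b) - c *\<^sub>R r *\<^sub>R resolvent A c b
        = r *\<^sub>R (A (resolvent A c b) - c *\<^sub>R resolvent A c b)"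
      by (simp add: linear_scale[OF lin] algebra_simps)
    then show "A (r *\<^sub>R resolvent A c b) - c *\<^sub>R r *\<^sub>R resolvent A c b = r *\<^sub>R b"
      by (simp add: resolvent_right)
  qed
qed

lemma resolvent_self_adjoint: "resolvent A c z \<bullet> z' = z \<bullet> resolvent A c z'"
proof -
  let ?R = "resolvent A c"
  have "?R z \<bullet> z' = ?R z \<bullet> (A (?R z') - c *\<^sub>R ?R z')"
    by (simp add: resolvent_right)
  also have "\<dots> = (A (?R z) - c *\<^sub>R ?R z) \<bullet> ?R z'"
    by (simp add: inner_diff_left inner_diff_right self_adjoint)
  finally show ?thesis
    by (simp add: resolvent_right)
qed

text \<open>
The Sherman-Morrison formula for adding the rank one operator \<open>z \<mapsto> \<langle>v, z\<rangle> v\<close> to \<open>A\<close>.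
\<close>

lemma resolvent_rank_one_update:
  assumes A': "\<And>z. A' z = A z + (v \<bullet> z) *\<^sub>R v"
    and A'_reg: "regular_value A' c"
    and nz: "1 + v \<bullet> resolvent A c v \<noteq> 0"
  shows "resolvent A' c z = resolvent A c z
    - ((v \<bullet> resolvent A c z) / (1 + v \<bullet> resolvent A c v)) *\<^sub>R resolvent A c v"
proof (rule regular_value.resolvent_eqI[OF A'_reg])
  let ?R = "resolvent A c"
  define k where "k = (v \<bullet> ?R z) / (1 + v \<bullet> ?R v)"
  have k: "v \<bullet> ?R z - k * (v \<bullet> ?R v) = k"
  proof -
    have "k * (1 + v \<bullet> ?R v) = v \<bullet> ?R z" using nz by (simp add: k_def)
    then show ?thesis by (simp add: algebra_simps)
  qed
  have "A' (?R z - k *\<^sub>R ?R v) - c *\<^sub>R (?R z - k *\<^sub>R ?R v)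
    = (A (?R z) - c *\<^sub>R ?R z) - k *\<^sub>R (A (?R v) - c *\<^sub>R ?R v)
        + (v \<bullet> ?R z - k * (v \<bullet> ?R v)) *\<^sub>R v"
    unfolding A'
    by (simp add: linear_diff[OF lin] linear_scale[OF lin] inner_diff_right algebra_simps)
  also have "\<dots> = z - k *\<^sub>R v + k *\<^sub>R v"
    by (simp only: k resolvent_right)
  finally show "A' (?R z - ((v \<bullet> ?R z) / (1 + v \<bullet> ?R v)) *\<^sub>R ?R v)
      - c *\<^sub>R (?R z - ((v \<bullet> ?R z) / (1 + v \<bullet> ?R v)) *\<^sub>R ?R v) = z"
    by (simp add: k_def)
qed

end

text \<open>
The resolvent identity \<open>R\<^sub>c - R\<^sub>d = (c - d) R\<^sub>c R\<^sub>d\<close>, here with \<open>d\<close> for \<open>c'\<close>, applied twice so that the difference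
of the quadratic forms is expressed at the single vector \<open>y = R\<^sub>d x\<close>. Its main term
\<open>\<parallel>y\<parallel>\<^sup>2\<close> is what the Bessel inequality yields when the Sherman-Morrison corrections are
summed over all candidates, so that potential drop and corrections can be compared.
\<close>

lemma resolvent_identity_quadratic:
  fixes x :: "'a::euclidean_space"
  assumes "regular_value A c" "regular_value A c'"
  defines "y \<equiv> resolvent A c' x"
  shows "x \<bullet> resolvent A c x - x \<bullet> resolvent A c' x
    = (c - c') * ((norm y)\<^sup>2 + (c - c') * (y \<bullet> resolvent A c y))"
proof -
  interpret C: regular_value A c by fact
  interpret C': regular_value A c' by fact
  let ?R = "resolvent A c"
  have Rx: "?R x = y + (c - c') *\<^sub>R ?R y"
  proof (rule C.resolvent_eqI)
    have "A (y + (c - c') *\<^sub>R ?R y) - c *\<^sub>R (y + (c - c') *\<^sub>R ?R y)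
      = (A y - c' *\<^sub>R y) - (c - c') *\<^sub>R y + (c - c') *\<^sub>R (A (?R y) - c *\<^sub>R ?R y)"
      by (simp add: linear_add[OF C.lin] linear_diff[OF C.lin] linear_scale[OF C.lin] algebra_simps)
    also have "\<dots> = x"
      unfolding C.resolvent_right y_def C'.resolvent_right by simp
    finally show "A (y + (c - c') *\<^sub>R ?R y) - c *\<^sub>R (y + (c - c') *\<^sub>R ?R y) = x" .
  qed
  have "x \<bullet> ?R y = ?R x \<bullet> y"
    by (simp add: C.resolvent_self_adjoint)
  also have "\<dots> = (norm y)\<^sup>2 + (c - c') * (y \<bullet> ?R y)"
    by (simp add: Rx inner_add_left inner_add_right power2_norm_eq_inner C.resolvent_self_adjoint)
  finally have 1: "x \<bullet> ?R y = (norm y)\<^sup>2 + (c - c') * (y \<bullet> ?R y)" .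
  have "x \<bullet> ?R x = x \<bullet> y + (c - c') * (x \<bullet> ?R y)"
    by (simp add: Rx inner_add_right)
  then show ?thesis
    using 1 by (simp add: y_def)
qed

section \<open>The upper barrier\<close>

lemma regular_value_above:
  assumes "\<And>z. z \<noteq> 0 \<Longrightarrow> (\<Sum>j\<in>\<sigma>. (w j \<bullet> z)\<^sup>2) < u * (norm z)\<^sup>2"
  shows "regular_value (frame_op \<sigma> w) u"
proof (rule regular_value.intro)
  show "z = 0" if "frame_op \<sigma> w z = u *\<^sub>R z" for z
    using assms[of z] inner_frame_op[of z \<sigma> w] that by (auto simp: power2_norm_eq_inner)
qed (rule linear_frame_op frame_op_self_adjoint)+

lemma resolvent_nonpos_above:
  assumes "\<And>z. z \<noteq> 0 \<Longrightarrow> (\<Sum>j\<in>\<sigma>. (w j \<bullet> z)\<^sup>2) < u * (norm z)\<^sup>2"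
  shows "x \<bullet> resolvent (frame_op \<sigma> w) u x \<le> 0"
proof -
  let ?A = "frame_op \<sigma> w" let ?y = "resolvent ?A u x"
  interpret regular_value ?A u by (rule regular_value_above) fact
  have "x \<bullet> ?y = ?y \<bullet> (?A ?y - u *\<^sub>R ?y)"
    by (simp add: resolvent_right inner_commute)
  also have "\<dots> = (\<Sum>j\<in>\<sigma>. (w j \<bullet> ?y)\<^sup>2) - u * (norm ?y)\<^sup>2"
    by (simp add: inner_diff_right inner_frame_op power2_norm_eq_inner)
  also have "\<dots> \<le> 0"
    using assms[of ?y] by (cases "?y = 0") auto
  finally show ?thesis .
qed

text \<open>
The largest eigenvalue stays below \<open>u\<close> when \<open>\<langle>v, (u - A)\<inverse> v\<rangle> < 1\<close>: in the inner product
given by \<open>u - A\<close>, the functional \<open>\<langle>v, \<cdot>\<rangle>\<close> has squared norm \<open>\<langle>v, (u - A)\<inverse> v\<rangle>\<close>.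
\<close>

lemma upper_bound_rank_one_update:
  assumes up: "\<And>z. z \<noteq> 0 \<Longrightarrow> (\<Sum>j\<in>\<sigma>. (w j \<bullet> z)\<^sup>2) < u * (norm z)\<^sup>2"
    and v: "- (v \<bullet> resolvent (frame_op \<sigma> w) u v) < 1"
    and "z \<noteq> 0"
  shows "(\<Sum>j\<in>\<sigma>. (w j \<bullet> z)\<^sup>2) + (v \<bullet> z)\<^sup>2 < u * (norm z)\<^sup>2"
proof -
  let ?A = "frame_op \<sigma> w" let ?y = "resolvent ?A u v"
  define Q where "Q z = u * (norm z)\<^sup>2 - z \<bullet> ?A z" for z
  define b where "b = v \<bullet> z"
  interpret regular_value ?A u by (rule regular_value_above) fact
  have Q_pos: "0 < Q z'" if "z' \<noteq> 0" for z'
    using up[OF that] by (simp add: Q_def inner_frame_op)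
  have Q_nonneg: "0 \<le> Q z'" for z'
    using Q_pos[of z'] by (cases "z' = 0") (auto simp: Q_def)
  have Ay: "?A ?y = v + u *\<^sub>R ?y"
    using resolvent_right[of v] by (simp add: algebra_simps)
  \<comment> \<open>The form \<open>Q\<close> is positive; evaluating it at \<open>z + b *\<^sub>R y\<close> with \<open>y = - (u - A)\<inverse> v\<close>
    gives the inequality of Cauchy-Schwarz type that bounds \<open>b\<^sup>2\<close> by \<open>Q z\<close>.\<close>
  have zy: "z \<bullet> ?A ?y = b + u * (z \<bullet> ?y)" "?y \<bullet> ?A z = b + u * (z \<bullet> ?y)"
    "?y \<bullet> ?A ?y = v \<bullet> ?y + u * (?y \<bullet> ?y)"
    using self_adjoint[of ?y z]
    by (simp_all add: Ay inner_add_right inner_add_left b_def inner_commute)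
  have "Q (z + b *\<^sub>R ?y) = Q z - 2 * b * b - b * b * (v \<bullet> ?y)"
    by (simp add: Q_def power2_norm_eq_inner linear_add[OF lin] linear_scale[OF lin]
      inner_add_left inner_add_right zy inner_commute[of ?y z] algebra_simps)
  then have Qz: "b * b * (2 + v \<bullet> ?y) \<le> Q z"
    using Q_nonneg[of "z + b *\<^sub>R ?y"] by (simp add: algebra_simps)
  have "b * b < Q z"
  proof (cases "b = 0")
    case True
    then show ?thesis using Q_pos[OF \<open>z \<noteq> 0\<close>] by simp
  next
    case False
    then have "b * b * 1 < b * b * (2 + v \<bullet> ?y)"
      using v by (intro mult_strict_left_mono) (auto simp: zero_less_mult_iff)
    with Qz show ?thesis by simp
  qed
  then show ?thesis
    by (simp add: Q_def inner_frame_op b_def power2_eq_square)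
qed

section \<open>The lower barrier\<close>

text \<open>
The lower bound is stated for the Gram matrix of the vectors instead of the frame operator.
The two have the same nonzero eigenvalues, but the Gram matrix has no kernel to be set aside:
a positive bound contains the linear independence of the vectors, and it is the
form in which the estimate is finally used.
\<close>

locale gram_bounded_below =
  fixes \<sigma> :: "'i set" and w :: "'i \<Rightarrow> 'a::euclidean_space" and l :: real
  assumes fin: "finite \<sigma>" and l_pos: "0 < l"
    and gram: "\<And>a. \<exists>j\<in>\<sigma>. a j \<noteq> 0 \<Longrightarrow>
      l * (\<Sum>j\<in>\<sigma>. (a j)\<^sup>2) < (norm (\<Sum>j\<in>\<sigma>. a j *\<^sub>R w j))\<^sup>2"
begin

lemma gram_weak: "l * (\<Sum>j\<in>\<sigma>. (a j)\<^sup>2) \<le> (norm (\<Sum>j\<in>\<sigma>. a j *\<^sub>R w j))\<^sup>2"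
  using gram[of a] by (cases "\<exists>j\<in>\<sigma>. a j \<noteq> 0") (auto intro: less_imp_le)

lemma frame_op_in_span: "frame_op \<sigma> w z \<in> span (w ` \<sigma>)"
  unfolding frame_op_def by (intro span_sum span_scale span_base) auto

lemma span_combination:
  assumes "z \<in> span (w ` \<sigma>)"
  obtains a where "z = (\<Sum>j\<in>\<sigma>. a j *\<^sub>R w j)"
proof -
  let ?V = "range (\<lambda>a. \<Sum>j\<in>\<sigma>. a j *\<^sub>R w j)"
  have "span (w ` \<sigma>) \<subseteq> ?V"
  proof (rule span_minimal)
    show "w ` \<sigma> \<subseteq> ?V"
    proof clarify
      fix j assume "j \<in> \<sigma>"
      have "w j = (\<Sum>i\<in>\<sigma>. (if i = j then 1 else 0) *\<^sub>R w i)"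
        using \<open>j \<in> \<sigma>\<close> fin by (simp add: if_distrib[of "\<lambda>r. r *\<^sub>R _"] sum.delta cong: if_cong)
      then show "w j \<in> ?V" by (rule range_eqI[of _ _ "\<lambda>i. if i = j then 1 else 0"])
    qed
    show "subspace ?V"
    proof (rule subspaceI)
      show "0 \<in> ?V" by (rule range_eqI[of _ _ "\<lambda>_. 0"]) simp
      show "x + y \<in> ?V" if xy: "x \<in> ?V" "y \<in> ?V" for x y
      proof -
        obtain a b where "x = (\<Sum>j\<in>\<sigma>. a j *\<^sub>R w j)" "y = (\<Sum>j\<in>\<sigma>. b j *\<^sub>R w j)"
          using xy by blast
        then show ?thesis
          by (intro range_eqI[of _ _ "\<lambda>j. a j + b j"]) (simp add: scaleR_add_left sum.distrib)
      qed
      show "r *\<^sub>R x \<in> ?V" if x: "x \<in> ?V" for r x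
      proof -
        obtain a where "x = (\<Sum>j\<in>\<sigma>. a j *\<^sub>R w j)"
          using x by blast
        then show ?thesis
          by (intro range_eqI[of _ _ "\<lambda>j. r * a j"]) (simp add: scaleR_sum_right)
      qed
    qed
  qed
  then show ?thesis using assms that by blast
qed

text \<open>
This is the passage from the Gram matrix \<open>X\<^sup>t X\<close> to the frame operator \<open>X X\<^sup>t\<close>. For \<open>z = X a\<close>,
Cauchy-Schwarz gives \<open>\<parallel>z\<parallel>\<^sup>4 = \<langle>a, X\<^sup>t z\<rangle>\<^sup>2 \<le> \<parallel>a\<parallel>\<^sup>2 \<langle>z, X X\<^sup>t z\<rangle>\<close>, and \<open>l \<parallel>a\<parallel>\<^sup>2 < \<parallel>z\<parallel>\<^sup>2\<close>.
\<close>

lemma frame_op_coercive_on_span: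
  assumes "z \<in> span (w ` \<sigma>)" "z \<noteq> 0"
  shows "l * (norm z)\<^sup>2 < z \<bullet> frame_op \<sigma> w z"
proof -
  obtain a where z: "z = (\<Sum>j\<in>\<sigma>. a j *\<^sub>R w j)"
    using span_combination[OF assms(1)] .
  define N S E where "N = (norm z)\<^sup>2" and "S = (\<Sum>j\<in>\<sigma>. (a j)\<^sup>2)"
    and "E = z \<bullet> frame_op \<sigma> w z"
  have "\<exists>j\<in>\<sigma>. a j \<noteq> 0"
    using \<open>z \<noteq> 0\<close> z by (metis (mono_tags, lifting) scale_eq_0_iff sum.neutral)
  then have lS: "l * S < N"
    using gram[of a] by (simp add: N_def S_def z)
  have N_pos: "0 < N" using \<open>z \<noteq> 0\<close> by (simp add: N_def)
  have "N = (\<Sum>j\<in>\<sigma>. a j * (w j \<bullet> z))"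
    unfolding N_def power2_norm_eq_inner by (subst (1) z) (simp add: inner_sum_left)
  then have "N\<^sup>2 \<le> S * E"
    unfolding S_def E_def inner_frame_op by (simp add: Cauchy_Schwarz_ineq_sum)
  moreover have "0 < N\<^sup>2" using N_pos by simp
  moreover have "0 \<le> S" unfolding S_def by (rule sum_nonneg) simp
  ultimately have E_pos: "0 < E"
    by (smt (verit) mult_nonneg_nonpos)
  have "N * (l * N) = l * N\<^sup>2" by (simp add: power2_eq_square)
  also have "\<dots> \<le> l * S * E"
    using \<open>N\<^sup>2 \<le> S * E\<close> l_pos by simp
  also have "\<dots> < N * E"
    using lS E_pos by simp
  finally show ?thesis using N_pos by (simp add: N_def E_def)
qed

lemma regular_value_below:
  assumes "0 < c" "c \<le> l"
  shows "regular_value (frame_op \<sigma> w) c"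
proof (rule regular_value.intro)
  show "z = 0" if eig: "frame_op \<sigma> w z = c *\<^sub>R z" for z
  proof (rule ccontr)
    assume "z \<noteq> 0"
    have "z = (1 / c) *\<^sub>R frame_op \<sigma> w z" using eig \<open>0 < c\<close> by simp
    then have "z \<in> span (w ` \<sigma>)" using frame_op_in_span span_scale by metis
    then have "l * (norm z)\<^sup>2 < c * (norm z)\<^sup>2"
      using frame_op_coercive_on_span \<open>z \<noteq> 0\<close> eig by (fastforce simp: power2_norm_eq_inner)
    with \<open>z \<noteq> 0\<close> \<open>c \<le> l\<close> show False by simp
  qed
qed (rule linear_frame_op frame_op_self_adjoint)+

text \<open>
The frame operator leaves the span of the vectors invariant and vanishes on its orthogonal
complement. For \<open>0 < c \<le> l\<close> its resolvent therefore splits into a nonnegative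
operator on the span and \<open>- 1 / c\<close> on the complement, which is the next lemma.
\<close>

lemma resolvent_on_span:
  assumes c: "0 < c" "c \<le> l" and p: "p \<in> span (w ` \<sigma>)"
  shows "resolvent (frame_op \<sigma> w) c p \<in> span (w ` \<sigma>)"
    and "0 \<le> p \<bullet> resolvent (frame_op \<sigma> w) c p"
proof -
  let ?A = "frame_op \<sigma> w" let ?y = "resolvent ?A c p"
  interpret regular_value ?A c by (rule regular_value_below) fact+
  have "?y = (1 / c) *\<^sub>R (?A ?y - p)"
    using resolvent_right[of p] \<open>0 < c\<close> by (simp add: algebra_simps)
  moreover have "(1 / c) *\<^sub>R (?A ?y - p) \<in> span (w ` \<sigma>)"
    by (intro span_scale span_diff frame_op_in_span p)
  ultimately show y: "?y \<in> span (w ` \<sigma>)" by simp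
  have "p \<bullet> ?y = ?y \<bullet> (?A ?y - c *\<^sub>R ?y)"
    by (simp add: resolvent_right inner_commute)
  also have "\<dots> = ?y \<bullet> ?A ?y - c * (norm ?y)\<^sup>2"
    by (simp add: inner_diff_right power2_norm_eq_inner)
  also have "\<dots> \<ge> 0"
  proof (cases "?y = 0")
    case False
    have "c * (norm ?y)\<^sup>2 \<le> l * (norm ?y)\<^sup>2" using \<open>c \<le> l\<close> by (intro mult_right_mono) auto
    with frame_op_coercive_on_span[OF y False] show ?thesis by simp
  qed simp
  finally show "0 \<le> p \<bullet> ?y" .
qed

lemma resolvent_orthogonal_to_span:
  assumes c: "0 < c" "c \<le> l" and q: "\<And>v. v \<in> span (w ` \<sigma>) \<Longrightarrow> q \<bullet> v = 0"
  shows "resolvent (frame_op \<sigma> w) c q = - (1 / c) *\<^sub>R q"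
proof -
  interpret regular_value "frame_op \<sigma> w" c by (rule regular_value_below) fact+
  have "w j \<bullet> q = 0" if "j \<in> \<sigma>" for j
    using q[of "w j"] that by (simp add: span_base inner_commute)
  then have "frame_op \<sigma> w (r *\<^sub>R q) = 0" for r by (simp add: frame_op_def)
  then show ?thesis
    by (intro resolvent_eqI) (use c in \<open>simp add: linear_neg[OF lin]\<close>)
qed

text \<open>
Counterpart of \<open>upper_bound_rank_one_update\<close>: by a Schur complement, the enlarged Gram matrix
stays above \<open>l\<close> when \<open>\<langle>v, (A - l)\<inverse> v\<rangle> < -1\<close>. With \<open>y = (A - l)\<inverse> v\<close> the new vector is
\<open>v = X X\<^sup>t y - l y\<close>, hence a combination \<open>X a + t v\<close> equals \<open>X (a + t X\<^sup>t y) - t l y\<close>, and in the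
coefficients \<open>a' = a + t X\<^sup>t y\<close> all mixed terms cancel.
\<close>

lemma gram_rank_one_update:
  assumes j: "j \<notin> \<sigma>" and v: "v \<bullet> resolvent (frame_op \<sigma> w) l v < - 1"
    and a: "\<exists>i\<in>insert j \<sigma>. a i \<noteq> 0"
  shows "l * (\<Sum>i\<in>insert j \<sigma>. (a i)\<^sup>2)
    < (norm (\<Sum>i\<in>insert j \<sigma>. a i *\<^sub>R (w(j := v)) i))\<^sup>2"
proof -
  let ?A = "frame_op \<sigma> w"
  define y where "y = resolvent ?A l v"
  define t where "t = a j"
  interpret regular_value ?A l by (rule regular_value_below) (use l_pos in auto)
  define b where "b i = w i \<bullet> y" for i
  define a' where "a' i = a i + t * b i" for i
  let ?X = "\<Sum>i\<in>\<sigma>. a' i *\<^sub>R w i"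
  have Ay: "?A y = v + l *\<^sub>R y"
    using resolvent_right[of v] by (simp add: algebra_simps y_def)
  have Ab: "?A y = (\<Sum>i\<in>\<sigma>. b i *\<^sub>R w i)" by (simp add: frame_op_def b_def)
  have bb: "(\<Sum>i\<in>\<sigma>. (b i)\<^sup>2) = y \<bullet> v + l * (y \<bullet> y)"
    using inner_frame_op[of y \<sigma> w] by (simp add: Ay inner_add_right b_def)
  have Xy: "?X \<bullet> y = (\<Sum>i\<in>\<sigma>. a' i * b i)" by (simp add: inner_sum_left b_def)
  have same: "(\<Sum>i\<in>\<sigma>. a i *\<^sub>R (w(j := v)) i) = (\<Sum>i\<in>\<sigma>. a i *\<^sub>R w i)"
    using j by (intro sum.cong) auto
  have comb: "(\<Sum>i\<in>insert j \<sigma>. a i *\<^sub>R (w(j := v)) i) = ?X - (t * l) *\<^sub>R y"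
  proof -
    have "?X = (\<Sum>i\<in>\<sigma>. a i *\<^sub>R w i) + t *\<^sub>R ?A y"
      by (simp add: a'_def Ab scaleR_add_left sum.distrib scaleR_sum_right)
    then show ?thesis
      using fin j by (simp add: same Ay t_def algebra_simps fun_upd_same del: fun_upd_apply)

  qed
  have coeff: "(\<Sum>i\<in>insert j \<sigma>. (a i)\<^sup>2)
    = t\<^sup>2 + (\<Sum>i\<in>\<sigma>. (a' i)\<^sup>2) - 2 * t * (\<Sum>i\<in>\<sigma>. a' i * b i) + t\<^sup>2 * (\<Sum>i\<in>\<sigma>. (b i)\<^sup>2)"
  proof -
    have "(a i)\<^sup>2 = (a' i)\<^sup>2 - 2 * t * (a' i * b i) + t\<^sup>2 * (b i)\<^sup>2" for i
      by (simp add: a'_def power2_eq_square algebra_simps)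
    then have "(\<Sum>i\<in>\<sigma>. (a i)\<^sup>2)
        = (\<Sum>i\<in>\<sigma>. (a' i)\<^sup>2) - 2 * t * (\<Sum>i\<in>\<sigma>. a' i * b i) + t\<^sup>2 * (\<Sum>i\<in>\<sigma>. (b i)\<^sup>2)"
      by (simp add: sum.distrib sum_subtractf sum_distrib_left)
    then show ?thesis using fin j by (simp add: t_def)
  qed
  have "(norm (?X - (t * l) *\<^sub>R y))\<^sup>2 = (norm ?X)\<^sup>2 - 2 * t * l * (?X \<bullet> y) + t\<^sup>2 * l\<^sup>2 * (y \<bullet> y)"
    unfolding power2_norm_eq_inner
    by (simp add: inner_diff_left inner_diff_right inner_commute power2_eq_square algebra_simps)
  then have key: "(norm (?X - (t * l) *\<^sub>R y))\<^sup>2 - l * (\<Sum>i\<in>insert j \<sigma>. (a i)\<^sup>2)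
    = ((norm ?X)\<^sup>2 - l * (\<Sum>i\<in>\<sigma>. (a' i)\<^sup>2)) + l * t\<^sup>2 * (- (v \<bullet> y) - 1)"
    unfolding coeff bb Xy by (simp add: inner_commute power2_eq_square algebra_simps)
  have "0 < ((norm ?X)\<^sup>2 - l * (\<Sum>i\<in>\<sigma>. (a' i)\<^sup>2)) + l * t\<^sup>2 * (- (v \<bullet> y) - 1)"
  proof (cases "t = 0")
    case True
    then have "\<exists>i\<in>\<sigma>. a' i \<noteq> 0" using a by (auto simp: a'_def t_def)
    then show ?thesis using gram[of a'] True by simp
  next
    case False
    have "0 < l * t\<^sup>2 * (- (v \<bullet> y) - 1)"
      using False l_pos v by (intro mult_pos_pos) (auto simp: y_def)
    then show ?thesis using gram_weak[of a'] by simp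
  qed
  with key show ?thesis unfolding comb by linarith
qed

end


section \<open>Selecting vectors from a Bessel family\<close>

lemma exists_less_if_sum_less:
  fixes U L :: "'i \<Rightarrow> real"
  assumes "(\<Sum>j\<in>I. U j) < (\<Sum>j\<in>I. L j)"
  obtains j where "j \<in> I" "U j < L j"
  using assms sum_mono[of I L U] by (meson not_le)

locale bessel_family =
  fixes I :: "'i set" and x :: "'i \<Rightarrow> 'a::euclidean_space"
  assumes finite_index: "finite I"
    and bessel: "\<And>z. (\<Sum>i\<in>I. (x i \<bullet> z)\<^sup>2) \<le> (norm z)\<^sup>2"
begin

definition energy :: real where
  "energy = (\<Sum>i\<in>I. (norm (x i))\<^sup>2)"

text \<open>
The trace of \<open>(A - c)\<inverse>\<close> composed with the frame operator of the whole family. It is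
written out over the family, so that summing a condition over all candidates \<open>x\<^sub>j\<close>
produces this expression literally.
\<close>

definition potential :: "'i set \<Rightarrow> ('i \<Rightarrow> 'a) \<Rightarrow> real \<Rightarrow> real" where
  "potential \<sigma> w c = (\<Sum>i\<in>I. x i \<bullet> resolvent (frame_op \<sigma> w) c (x i))"

text \<open>
The numerator in the Sherman-Morrison correction of the potential when \<open>x\<^sub>j\<close> is added.
\<close>

definition interaction :: "'i set \<Rightarrow> ('i \<Rightarrow> 'a) \<Rightarrow> real \<Rightarrow> 'i \<Rightarrow> real" where
  "interaction \<sigma> w c j = (\<Sum>i\<in>I. (x i \<bullet> resolvent (frame_op \<sigma> w) c (x j))\<^sup>2)"

text \<open>
The invariant of the construction: \<open>w\<close> rescales the selected vectors by positive
weights, the Gram matrix of the result lies above \<open>l\<close> and its frame operator below \<open>u\<close>. Both bounds are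
strict, so that \<open>u\<close> and, if positive, \<open>l\<close> are regular values of the frame operator.
\<close>

definition confined :: "'i set \<Rightarrow> ('i \<Rightarrow> 'a) \<Rightarrow> real \<Rightarrow> real \<Rightarrow> bool" where
  "confined \<sigma> w l u \<longleftrightarrow> \<sigma> \<subseteq> I \<and> (\<forall>j\<in>\<sigma>. \<exists>r>0. w j = r *\<^sub>R x j) \<and>
    (\<forall>a. (\<exists>j\<in>\<sigma>. a j \<noteq> 0) \<longrightarrow>
      l * (\<Sum>j\<in>\<sigma>. (a j)\<^sup>2) < (norm (\<Sum>j\<in>\<sigma>. a j *\<^sub>R w j))\<^sup>2) \<and>
    (\<forall>z. z \<noteq> 0 \<longrightarrow> (\<Sum>j\<in>\<sigma>. (w j \<bullet> z)\<^sup>2) < u * (norm z)\<^sup>2)"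

lemma interaction_nonneg: "0 \<le> interaction \<sigma> w c j"
  by (simp add: interaction_def sum_nonneg)

text \<open>
The Bessel inequality at the vectors \<open>(A - c)\<inverse> x\<^sub>j\<close>.
\<close>

lemma sum_interaction_le:
  "(\<Sum>j\<in>I. interaction \<sigma> w c j) \<le> (\<Sum>j\<in>I. (norm (resolvent (frame_op \<sigma> w) c (x j)))\<^sup>2)"
  unfolding interaction_def by (intro sum_mono bessel)

lemma confined_gram: "confined \<sigma> w l u \<Longrightarrow> 0 < l \<Longrightarrow> gram_bounded_below \<sigma> w l"
  using finite_index finite_subset
  unfolding confined_def gram_bounded_below_def by blast

lemma confined_upper:
  "confined \<sigma> w l u \<Longrightarrow> z \<noteq> 0 \<Longrightarrow> (\<Sum>j\<in>\<sigma>. (w j \<bullet> z)\<^sup>2) < u * (norm z)\<^sup>2"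
  by (simp add: confined_def)

lemma confined_mono:
  assumes "confined \<sigma> w l u" "l' \<le> l" "u \<le> u'"
  shows "confined \<sigma> w l' u'"
proof -
  have "l' * (\<Sum>j\<in>\<sigma>. (a j)\<^sup>2) < (norm (\<Sum>j\<in>\<sigma>. a j *\<^sub>R w j))\<^sup>2" if "\<exists>j\<in>\<sigma>. a j \<noteq> 0" for a
  proof -
    have "l' * (\<Sum>j\<in>\<sigma>. (a j)\<^sup>2) \<le> l * (\<Sum>j\<in>\<sigma>. (a j)\<^sup>2)"
      using assms(2) by (intro mult_right_mono sum_nonneg) auto
    also have "\<dots> < (norm (\<Sum>j\<in>\<sigma>. a j *\<^sub>R w j))\<^sup>2"
      using assms(1) that unfolding confined_def by blast
    finally show ?thesis .
  qed
  moreover have "(\<Sum>j\<in>\<sigma>. (w j \<bullet> z)\<^sup>2) < u' * (norm z)\<^sup>2" if "z \<noteq> 0" for z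
  proof -
    have "u * (norm z)\<^sup>2 \<le> u' * (norm z)\<^sup>2"
      using assms(3) by (intro mult_right_mono) auto
    then show ?thesis using confined_upper[OF assms(1) that] by simp
  qed
  ultimately show ?thesis
    using assms(1) unfolding confined_def by blast
qed

text \<open>
Below the nonzero spectrum the resolvent is nonnegative on the span of the selected
vectors, so the condition that makes room for a new vector excludes repeated indices.
\<close>

lemma not_selected_if_resolvent_negative:
  assumes "confined \<sigma> w l u" "0 < l"
    and "x j \<bullet> resolvent (frame_op \<sigma> w) l (x j) < 0"
  shows "j \<notin> \<sigma>"
proof
  assume "j \<in> \<sigma>"
  interpret gram_bounded_below \<sigma> w l by (rule confined_gram) fact+
  obtain r where r: "r > 0" "w j = r *\<^sub>R x j"
    using assms(1) \<open>j \<in> \<sigma>\<close> unfolding confined_def by blast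
  have "x j = (1 / r) *\<^sub>R w j" using r by simp
  then have "x j \<in> span (w ` \<sigma>)"
    using \<open>j \<in> \<sigma>\<close> by (metis imageI span_base span_scale)
  then show False
    using resolvent_on_span(2)[of l "x j"] assms(2,3) by simp
qed

text \<open>
The parameter \<open>t\<close> is the reciprocal of the squared weight of \<open>x\<^sub>j\<close>. In terms of \<open>t\<close> both rank
one criteria are linear, one bounding \<open>t\<close> from below and the other from above.
\<close>

lemma confined_insert:
  assumes conf: "confined \<sigma> w l u" and l: "0 < l" and j: "j \<in> I" and t: "0 < t"
    and up: "- (x j \<bullet> resolvent (frame_op \<sigma> w) u (x j)) < t"
    and low: "t < - (x j \<bullet> resolvent (frame_op \<sigma> w) l (x j))"
  shows "confined (insert j \<sigma>) (w(j := (1 / sqrt t) *\<^sub>R x j)) l u"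
proof -
  let ?R = "resolvent (frame_op \<sigma> w)" and ?v = "(1 / sqrt t) *\<^sub>R x j"
  interpret G: gram_bounded_below \<sigma> w l by (rule confined_gram) fact+
  interpret L: regular_value "frame_op \<sigma> w" l
    by (rule G.regular_value_below) (use l in auto)
  interpret U: regular_value "frame_op \<sigma> w" u
    by (rule regular_value_above) (rule confined_upper[OF conf])
  have j_new: "j \<notin> \<sigma>"
    using not_selected_if_resolvent_negative[OF conf l] low t by simp
  have sq: "1 / sqrt t * (1 / sqrt t) = 1 / t"
    using t by simp
  have vu: "?v \<bullet> ?R u ?v = (x j \<bullet> ?R u (x j)) / t"
    using sq by (simp add: linear_scale[OF U.linear_resolvent])
  have vl: "?v \<bullet> ?R l ?v = (x j \<bullet> ?R l (x j)) / t"
    using sq by (simp add: linear_scale[OF L.linear_resolvent])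
  have "- (?v \<bullet> ?R u ?v) < 1" unfolding vu using up t by (simp add: field_simps)
  then have A: "(\<Sum>i\<in>insert j \<sigma>. ((w(j := ?v)) i \<bullet> z)\<^sup>2) < u * (norm z)\<^sup>2" if "z \<noteq> 0" for z
  proof -
    have "(\<Sum>i\<in>insert j \<sigma>. ((w(j := ?v)) i \<bullet> z)\<^sup>2) = (\<Sum>i\<in>\<sigma>. (w i \<bullet> z)\<^sup>2) + (?v \<bullet> z)\<^sup>2"
      unfolding inner_frame_op[symmetric] frame_op_insert[OF G.fin j_new]
      by (simp only: inner_add_right inner_scaleR_left inner_scaleR_right power2_eq_square
        inner_commute[of z "x j"])
    then show ?thesis
      using upper_bound_rank_one_update[OF confined_upper[OF conf] \<open>- (?v \<bullet> ?R u ?v) < 1\<close> that]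
      by simp
  qed
  have "?v \<bullet> ?R l ?v < - 1" unfolding vl using low t by (simp add: field_simps)
  then have B: "l * (\<Sum>i\<in>insert j \<sigma>. (a i)\<^sup>2) < (norm (\<Sum>i\<in>insert j \<sigma>. a i *\<^sub>R (w(j := ?v)) i))\<^sup>2"
    if "\<exists>i\<in>insert j \<sigma>. a i \<noteq> 0" for a
    using G.gram_rank_one_update[OF j_new _ that] by blast
  have C: "\<exists>r>0. (w(j := ?v)) i = r *\<^sub>R x i" if "i \<in> insert j \<sigma>" for i
  proof (cases "i = j")
    case True
    then show ?thesis using t by (intro exI[of _ "1 / sqrt t"]) simp
  next
    case False
    then show ?thesis using that conf unfolding confined_def by simp
  qed
  show ?thesis
    unfolding confined_def using A B C j conf by (auto simp: confined_def simp del: fun_upd_apply)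
qed

lemma potential_insert:
  assumes "finite \<sigma>" "j \<notin> \<sigma>" "0 < t"
    and "regular_value (frame_op \<sigma> w) c"
    and "regular_value (frame_op (insert j \<sigma>) (w(j := (1 / sqrt t) *\<^sub>R x j))) c"
    and nz: "t + x j \<bullet> resolvent (frame_op \<sigma> w) c (x j) \<noteq> 0"
  shows "potential (insert j \<sigma>) (w(j := (1 / sqrt t) *\<^sub>R x j)) c
    = potential \<sigma> w c - interaction \<sigma> w c j / (t + x j \<bullet> resolvent (frame_op \<sigma> w) c (x j))"
proof -
  let ?v = "(1 / sqrt t) *\<^sub>R x j" let ?R = "resolvent (frame_op \<sigma> w) c"
  let ?R' = "resolvent (frame_op (insert j \<sigma>) (w(j := ?v))) c"
  define s where "s = 1 / sqrt t"
  define \<beta> where "\<beta> = x j \<bullet> ?R (x j)"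
  have s: "s * s = 1 / t" using \<open>0 < t\<close> by (simp add: s_def)
  interpret regular_value "frame_op \<sigma> w" c by fact
  have vv: "?v \<bullet> ?R ?v = \<beta> / t"
    using s by (simp add: linear_scale[OF linear_resolvent] s_def[symmetric] \<beta>_def
        mult.assoc[symmetric])
  have nz': "1 + ?v \<bullet> ?R ?v \<noteq> 0"
    unfolding vv using nz \<open>0 < t\<close> by (simp add: \<beta>_def field_simps)
  have "x i \<bullet> ?R' (x i) = x i \<bullet> ?R (x i) - (x i \<bullet> ?R (x j))\<^sup>2 / (t + \<beta>)" for i
  proof -
    have R': "?R' (x i) = ?R (x i) - ((?v \<bullet> ?R (x i)) / (1 + ?v \<bullet> ?R ?v)) *\<^sub>R ?R ?v"
      by (rule resolvent_rank_one_update[OF frame_op_insert[OF assms(1,2)] assms(5) nz'])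
    have "?v \<bullet> ?R (x i) = s * (x i \<bullet> ?R (x j))"
      using resolvent_self_adjoint[of "x i" "x j"] by (simp add: s_def inner_commute)
    moreover have "x i \<bullet> ?R ?v = s * (x i \<bullet> ?R (x j))"
      by (simp add: linear_scale[OF linear_resolvent] s_def)
    ultimately have "x i \<bullet> ?R' (x i)
      = x i \<bullet> ?R (x i) - (s * s) * (x i \<bullet> ?R (x j))\<^sup>2 / (1 + \<beta> / t)"
      unfolding R' vv by (simp add: inner_diff_right power2_eq_square)
    also have "(s * s) * (x i \<bullet> ?R (x j))\<^sup>2 / (1 + \<beta> / t) = (x i \<bullet> ?R (x j))\<^sup>2 / (t + \<beta>)"
      unfolding s using \<open>0 < t\<close> by (simp add: divide_simps) 
    finally show ?thesis .
  qed
  then show ?thesis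
    by (simp add: potential_def interaction_def sum_subtractf sum_divide_distrib \<beta>_def)
qed

section \<open>How the potentials react to moving barriers\<close>

text \<open>
Moving the upper barrier by \<open>d\<close> gains at least \<open>d\<close> times the sum that bounds all interactions:
in \<open>resolvent_identity_quadratic\<close> the second order term has a favourable sign,
because \<open>A - u\<close> is negative definite.
\<close>

lemma upper_potential_drop:
  assumes conf: "confined \<sigma> w l u" and "0 < d"
  defines "D \<equiv> potential \<sigma> w (u + d) - potential \<sigma> w u"
  shows "d * (\<Sum>i\<in>I. (norm (resolvent (frame_op \<sigma> w) (u + d) (x i)))\<^sup>2) \<le> D"
    and "0 < energy \<Longrightarrow> 0 < D"
proof -
  let ?R = "resolvent (frame_op \<sigma> w)"
  have conf': "confined \<sigma> w l (u + d)"
    using confined_mono[OF conf] \<open>0 < d\<close> by simp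
  have "d * (norm (?R (u + d) (x i)))\<^sup>2 \<le> x i \<bullet> ?R (u + d) (x i) - x i \<bullet> ?R u (x i)" for i
  proof -
    let ?y = "?R (u + d) (x i)"
    have "x i \<bullet> ?R u (x i) - x i \<bullet> ?y = (u - (u + d)) * ((norm ?y)\<^sup>2 + (u - (u + d)) * (?y \<bullet> ?R u ?y))"
      by (intro resolvent_identity_quadratic regular_value_above
        confined_upper[OF conf] confined_upper[OF conf'])
    then have "x i \<bullet> ?y - x i \<bullet> ?R u (x i) = d * (norm ?y)\<^sup>2 - d * d * (?y \<bullet> ?R u ?y)"
      by (simp add: algebra_simps)
    moreover have "d * d * (?y \<bullet> ?R u ?y) \<le> 0"
      using resolvent_nonpos_above[OF confined_upper[OF conf]] by (simp add: mult_le_0_iff)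
    ultimately show ?thesis by simp
  qed
  then show drop: "d * (\<Sum>i\<in>I. (norm (?R (u + d) (x i)))\<^sup>2) \<le> D"
    unfolding D_def potential_def sum_distrib_left sum_subtractf[symmetric] by (intro sum_mono)
  show "0 < D" if "0 < energy"
  proof -
    interpret regular_value "frame_op \<sigma> w" "u + d"
      by (rule regular_value_above) (rule confined_upper[OF conf'])
    have "\<exists>i\<in>I. x i \<noteq> 0"
    proof (rule ccontr)
      assume "\<not> (\<exists>i\<in>I. x i \<noteq> 0)"
      then have "energy = 0" by (simp add: energy_def)
      with that show False by simp
    qed
    then obtain i where i: "i \<in> I" "x i \<noteq> 0" by blast
    then have "?R (u + d) (x i) \<noteq> 0"
      using resolvent_right[of "x i"] linear_0[OF lin] by auto
    then have "0 < (\<Sum>i\<in>I. (norm (?R (u + d) (x i)))\<^sup>2)"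
      using i finite_index by (intro sum_pos2[of _ i]) auto
    then have "0 < d * (\<Sum>i\<in>I. (norm (?R (u + d) (x i)))\<^sup>2)"
      using \<open>0 < d\<close> by simp
    then show ?thesis using drop by linarith
  qed
qed

text \<open>
A subspace spanned by \<open>k\<close> vectors carries at most energy \<open>k\<close>, by the Bessel inequality at each
vector of an orthonormal basis. \<open>Q\<close> is the orthogonal projection to the complement.
\<close>

lemma projection_energy:
  assumes fin: "finite S"
  obtains Q where "\<And>z. z - Q z \<in> span S" "\<And>z v. v \<in> span S \<Longrightarrow> Q z \<bullet> v = 0"
    and "energy - card S \<le> (\<Sum>i\<in>I. (norm (Q (x i)))\<^sup>2)"
proof -
  obtain B where B: "B \<subseteq> span S" "pairwise orthogonal B" "\<And>b. b \<in> B \<Longrightarrow> norm b = 1"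
    "independent B" "card B = dim (span S)" "span B = span S"
    using orthonormal_basis_subspace[OF subspace_span[of S]] by blast
  have finB: "finite B" using B(4) by (rule independent_imp_finite)
  have bb: "b \<bullet> b' = (if b = b' then 1 else 0)" if "b \<in> B" "b' \<in> B" for b b'
    using B(2,3) that by (auto simp: pairwise_def orthogonal_def norm_eq_1)
  define P where "P z = (\<Sum>b\<in>B. (z \<bullet> b) *\<^sub>R b)" for z :: 'a
  have P_in: "P z \<in> span S" for z
    unfolding P_def using B(1) by (intro span_sum span_scale) auto
  have Pb: "P z \<bullet> b = z \<bullet> b" if "b \<in> B" for z b
  proof -
    have "P z \<bullet> b = (\<Sum>b'\<in>B. if b' = b then z \<bullet> b' else 0)"
      unfolding P_def inner_sum_left using bb that by (intro sum.cong) auto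
    then show ?thesis using finB that by simp
  qed
  have orth: "(z - P z) \<bullet> v = 0" if "v \<in> span S" for z v
  proof -
    have "v \<in> span B" using that B(6) by simp
    then show ?thesis
    proof (induction rule: span_induct)
      show "subspace {a. (z - P z) \<bullet> a = 0}" by (rule subspace_hyperplane)
      show "b \<in> B \<Longrightarrow> (z - P z) \<bullet> b = 0" for b
        by (simp add: inner_diff_left Pb)
    qed
  qed
  have nQ: "(norm (z - P z))\<^sup>2 = (norm z)\<^sup>2 - (\<Sum>b\<in>B. (z \<bullet> b)\<^sup>2)" for z
  proof -
    have "(norm (z - P z))\<^sup>2 = (z - P z) \<bullet> z - (z - P z) \<bullet> P z"
      by (simp add: power2_norm_eq_inner inner_diff_right)
    also have "\<dots> = (norm z)\<^sup>2 - P z \<bullet> z"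
      using orth[OF P_in, of z z] by (simp add: inner_diff_left power2_norm_eq_inner)
    also have "P z \<bullet> z = (\<Sum>b\<in>B. (z \<bullet> b)\<^sup>2)"
      unfolding P_def inner_sum_left by (simp add: inner_commute power2_eq_square)
    finally show ?thesis .
  qed
  have "(\<Sum>i\<in>I. \<Sum>b\<in>B. (x i \<bullet> b)\<^sup>2) = (\<Sum>b\<in>B. \<Sum>i\<in>I. (x i \<bullet> b)\<^sup>2)"
    by (rule sum.swap)
  also have "\<dots> \<le> (\<Sum>b\<in>B. 1)"
    using bessel B(3) by (intro sum_mono) (metis one_power2)
  also have "\<dots> \<le> card S"
    using B(5) dim_le_card'[OF fin] by (simp add: dim_span)
  finally have "energy - card S \<le> (\<Sum>i\<in>I. (norm (x i - P (x i)))\<^sup>2)"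
    by (simp add: nQ sum_subtractf energy_def)
  then show ?thesis
    using that[of "\<lambda>z. z - P z"] P_in orth by simp
qed

text \<open>
For the lower barrier the second order term of \<open>resolvent_identity_quadratic\<close> is negative on the
complement of the span. There the resolvents are \<open>- 1 / l\<close> and \<open>- 1 / l'\<close> with
\<open>l' = l - d\<close>, so with \<open>\<beta>\<close> the energy of the complement and \<open>S\<close> the sum to be bounded one
obtains \<open>D \<ge> d S - d\<^sup>2 \<beta> / (l'\<^sup>2 l)\<close> and \<open>D \<ge> d \<beta> / (l l')\<close>. The second estimate shows that the loss
in the first is at most \<open>d D\<^sup>2\<close> when \<open>l \<le> d \<beta>\<close>, which follows from \<open>projection_energy\<close>. The term \<open>D\<^sup>2\<close> in the conclusion is
harmless, since \<open>D\<close> is also the amount by which the potential at \<open>l'\<close> falls below the one at \<open>l\<close>.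
\<close>

lemma lower_potential_drop:
  assumes conf: "confined \<sigma> w l u" and d: "0 < d" "d < l"
    and large: "l \<le> d * (energy - card \<sigma>)"
  defines "D \<equiv> potential \<sigma> w l - potential \<sigma> w (l - d)"
  shows "0 < D"
    and "(\<Sum>i\<in>I. (norm (resolvent (frame_op \<sigma> w) (l - d) (x i)))\<^sup>2) \<le> D * (D + 1 / d)"
proof -
  let ?R = "resolvent (frame_op \<sigma> w)"
  define l' where "l' = l - d"
  have l': "0 < l'" "l' \<le> l" and l: "0 < l" using d by (auto simp: l'_def)
  interpret G: gram_bounded_below \<sigma> w l by (rule confined_gram[OF conf l])
  interpret L: regular_value "frame_op \<sigma> w" l by (rule G.regular_value_below) (use l in auto)
  interpret L': regular_value "frame_op \<sigma> w" l' by (rule G.regular_value_below) (use l' in auto)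
  obtain Q where Q: "\<And>z. z - Q z \<in> span (w ` \<sigma>)" "\<And>z v. v \<in> span (w ` \<sigma>) \<Longrightarrow> Q z \<bullet> v = 0"
    "energy - card (w ` \<sigma>) \<le> (\<Sum>i\<in>I. (norm (Q (x i)))\<^sup>2)"
    using projection_energy[of "w ` \<sigma>"] G.fin by blast
  define \<beta> where "\<beta> = (\<Sum>i\<in>I. (norm (Q (x i)))\<^sup>2)"
  define S where "S = (\<Sum>i\<in>I. (norm (?R l' (x i)))\<^sup>2)"
  have "energy - card \<sigma> \<le> \<beta>"
    using Q(3) card_image_le[OF G.fin, of w] by (simp add: \<beta>_def)
  then have "d * (energy - card \<sigma>) \<le> d * \<beta>" using d(1) by simp
  then have d\<beta>: "l \<le> d * \<beta>" using large by linarith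
  \<comment> \<open>The resolvent at \<open>l'\<close> maps \<open>x i\<close> to \<open>p + q\<close> with \<open>p\<close> in the span and \<open>q\<close> orthogonal to it.\<close>
  have each: "(norm (Q (x i)))\<^sup>2 / l'\<^sup>2 \<le> (norm (?R l' (x i)))\<^sup>2"
    "d * ((norm (?R l' (x i)))\<^sup>2 - d * ((norm (Q (x i)))\<^sup>2 / (l'\<^sup>2 * l)))
      \<le> x i \<bullet> ?R l (x i) - x i \<bullet> ?R l' (x i)" for i
  proof -
    define q where "q = - (1 / l') *\<^sub>R Q (x i)"
    define p where "p = ?R l' (x i - Q (x i))"
    let ?y = "?R l' (x i)"
    have p_in: "p \<in> span (w ` \<sigma>)"
      unfolding p_def by (rule G.resolvent_on_span[OF l' Q(1)])
    have "?y = p + ?R l' (Q (x i))"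
      by (simp add: p_def linear_diff[OF L'.linear_resolvent])
    then have y: "?y = p + q"
      using G.resolvent_orthogonal_to_span[OF l' Q(2)] by (simp add: q_def)
    have q_orth: "q \<bullet> v = 0" if "v \<in> span (w ` \<sigma>)" for v
      by (simp add: q_def Q(2)[OF that])
    have nq: "(norm q)\<^sup>2 = (norm (Q (x i)))\<^sup>2 / l'\<^sup>2"
      by (simp add: q_def power_mult_distrib power_divide)
    have ny: "(norm ?y)\<^sup>2 = (norm p)\<^sup>2 + (norm q)\<^sup>2"
      unfolding y power2_norm_eq_inner using q_orth[OF p_in]
      by (simp add: inner_add_left inner_add_right inner_commute)
    then show "(norm (Q (x i)))\<^sup>2 / l'\<^sup>2 \<le> (norm ?y)\<^sup>2"
      by (simp add: nq)
    have Rq: "?R l q = - (1 / l) *\<^sub>R q"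
      by (rule G.resolvent_orthogonal_to_span[OF l order_refl q_orth])
    have Rp: "?R l p \<in> span (w ` \<sigma>)" "0 \<le> p \<bullet> ?R l p"
      using G.resolvent_on_span[OF l order_refl p_in] by auto
    have "?y \<bullet> ?R l ?y = p \<bullet> ?R l p - (norm q)\<^sup>2 / l"
      unfolding y linear_add[OF L.linear_resolvent] Rq
      using q_orth[OF Rp(1)] q_orth[OF p_in]
      by (simp add: inner_add_left inner_add_right inner_diff_right inner_commute power2_norm_eq_inner)
    then have Ry: "- ((norm (Q (x i)))\<^sup>2 / (l'\<^sup>2 * l)) \<le> ?y \<bullet> ?R l ?y"
      using Rp(2) by (simp add: nq)
    have "x i \<bullet> ?R l (x i) - x i \<bullet> ?y = (l - l') * ((norm ?y)\<^sup>2 + (l - l') * (?y \<bullet> ?R l ?y))"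
      by (intro resolvent_identity_quadratic L.regular_value_axioms L'.regular_value_axioms)
    then have "x i \<bullet> ?R l (x i) - x i \<bullet> ?y = d * ((norm ?y)\<^sup>2 + d * (?y \<bullet> ?R l ?y))"
      by (simp add: l'_def)
    moreover have "d * ((norm ?y)\<^sup>2 - d * ((norm (Q (x i)))\<^sup>2 / (l'\<^sup>2 * l)))
        \<le> d * ((norm ?y)\<^sup>2 + d * (?y \<bullet> ?R l ?y))"
      using mult_left_mono[OF Ry, of d] d by (intro mult_left_mono) auto
    ultimately show "d * ((norm ?y)\<^sup>2 - d * ((norm (Q (x i)))\<^sup>2 / (l'\<^sup>2 * l)))
        \<le> x i \<bullet> ?R l (x i) - x i \<bullet> ?y" by simp
  qed
  define e where "e = \<beta> / (l'\<^sup>2 * l)"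
  have S: "e * l \<le> S"
  proof -
    have "(\<Sum>i\<in>I. (norm (Q (x i)))\<^sup>2 / l'\<^sup>2) \<le> S"
      unfolding S_def by (intro sum_mono each(1))
    moreover have "e * l = \<beta> / l'\<^sup>2" using l by (simp add: e_def)
    ultimately show ?thesis by (simp add: \<beta>_def sum_divide_distrib)
  qed
  have D: "d * (S - d * e) \<le> D"
  proof -
    have "d * (S - d * e) = (\<Sum>i\<in>I. d * ((norm (?R l' (x i)))\<^sup>2 - d * ((norm (Q (x i)))\<^sup>2 / (l'\<^sup>2 * l))))"
      by (simp add: S_def e_def \<beta>_def sum_subtractf sum_distrib_left sum_divide_distrib right_diff_distrib)
    also have "\<dots> \<le> D"
      unfolding D_def potential_def sum_subtractf[symmetric] l'_def[symmetric]
      by (intro sum_mono each(2))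
    finally show ?thesis .
  qed
  have \<beta>_pos: "0 < \<beta>" using less_le_trans[OF l d\<beta>] d(1) by (simp add: zero_less_mult_iff)
  then have e_pos: "0 < e" using l l' by (simp add: e_def)
  have "d * (e * l') \<le> d * (S - d * e)"
    using S d(1) by (intro mult_left_mono) (auto simp: l'_def algebra_simps)
  then have D2: "d * e * l' \<le> D" using D by simp
  have "0 < d * e * l'" using d(1) e_pos l' by simp
  then show D_pos: "0 < D" using D2 by simp
  \<comment> \<open>\<open>d * e\<close> is the loss on the complement; its comparison with \<open>D\<^sup>2\<close> rests on \<open>l \<le> d * \<beta>\<close>.\<close>
  have "d * e = d * e * l' * (l / (l * l'))" using l l' by simp
  also have "\<dots> \<le> d * e * l' * (d * \<beta> / (l * l'))"
    using d\<beta> l l' d(1) e_pos by (intro mult_left_mono divide_right_mono) auto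
  also have "d * \<beta> / (l * l') = d * e * l'"
    using l l' by (simp add: e_def power2_eq_square)
  also have "d * e * l' * (d * e * l') \<le> D * D"
    using D2 \<open>0 < d * e * l'\<close> by (intro mult_mono) auto
  finally have "d * e \<le> D * D" .
  moreover have "S \<le> D / d + d * e"
    using D d(1) by (simp add: field_simps)
  ultimately have "S \<le> D * (D + 1 / d)" by (simp add: algebra_simps)
  then show "(\<Sum>i\<in>I. (norm (?R (l - d) (x i)))\<^sup>2) \<le> D * (D + 1 / d)"
    by (simp add: S_def l'_def)
qed

section \<open>Selecting the vectors one at a time\<close>

text \<open>
The bounds \<open>U j\<close> and \<open>L j\<close> in the proof state when adding \<open>x j\<close> with squared weight \<open>1 / t\<close> does not
undo the gain from the barrier shifts: \<open>U j \<le> t\<close> does this for the upper potential and \<open>t \<le> L j\<close>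
for the lower one. Their sums satisfy \<open>\<Sum> U < \<beta> + 1 / d' \<le> \<alpha> - 1 / d \<le> \<Sum> L\<close>.
\<close>

lemma barrier_step:
  assumes conf: "confined \<sigma> w l u" and d: "0 < d" "d < l" and d': "0 < d'"
    and large: "l \<le> d * (energy - card \<sigma>)"
    and pot: "potential \<sigma> w l \<le> - \<alpha>" "- \<beta> \<le> potential \<sigma> w u"
    and balance: "\<beta> + 1 / d' \<le> \<alpha> - 1 / d"
  obtains \<sigma>' w' where "card \<sigma>' = Suc (card \<sigma>)" "confined \<sigma>' w' (l - d) (u + d')"
    "potential \<sigma>' w' (l - d) \<le> - \<alpha>" "- \<beta> \<le> potential \<sigma>' w' (u + d')"
proof -
  let ?R = "resolvent (frame_op \<sigma> w)"
  have l: "0 < l - d" using d by simp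
  have conf': "confined \<sigma> w (l - d) (u + d')"
    using confined_mono[OF conf] d d' by simp
  have fin: "finite \<sigma>"
    using conf finite_index finite_subset unfolding confined_def by blast
  have "0 < energy"
  proof -
    have "0 < d * (energy - card \<sigma>)" using large d by linarith
    then show ?thesis using d(1) by (simp add: zero_less_mult_iff)
  qed
  define Dl Du where "Dl = potential \<sigma> w l - potential \<sigma> w (l - d)"
    and "Du = potential \<sigma> w (u + d') - potential \<sigma> w u"
  have Dl: "0 < Dl" "(\<Sum>j\<in>I. interaction \<sigma> w (l - d) j) \<le> Dl * (Dl + 1 / d)"
    unfolding Dl_def
    using lower_potential_drop[OF conf d large] sum_interaction_le[of \<sigma> w "l - d"] by auto
  have Du: "0 < Du" "(\<Sum>j\<in>I. interaction \<sigma> w (u + d') j) \<le> Du / d'"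
  proof -
    show "0 < Du" unfolding Du_def using upper_potential_drop(2)[OF conf d' \<open>0 < energy\<close>] .
    have "(\<Sum>j\<in>I. interaction \<sigma> w (u + d') j)
        \<le> (\<Sum>i\<in>I. (norm (?R (u + d') (x i)))\<^sup>2)"
      by (rule sum_interaction_le)
    also have "\<dots> \<le> Du / d'"
      using upper_potential_drop(1)[OF conf d'] d' by (simp add: Du_def field_simps)
    finally show "(\<Sum>j\<in>I. interaction \<sigma> w (u + d') j) \<le> Du / d'" .
  qed
  define U where "U j = - (x j \<bullet> ?R (u + d') (x j)) + interaction \<sigma> w (u + d') j / Du" for j
  define L where "L j = - (x j \<bullet> ?R (l - d) (x j)) - interaction \<sigma> w (l - d) j / Dl" for j
  have "(\<Sum>j\<in>I. U j) = - potential \<sigma> w (u + d') + (\<Sum>j\<in>I. interaction \<sigma> w (u + d') j) / Du"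
    by (simp add: U_def potential_def sum.distrib sum_negf sum_divide_distrib sum_subtractf)
  also have "\<dots> \<le> - potential \<sigma> w (u + d') + 1 / d'"
    using Du by (simp add: pos_divide_le_eq)
  also have "\<dots> < \<beta> + 1 / d'"
    using pot(2) Du(1) by (simp add: Du_def)
  also have "\<dots> \<le> \<alpha> - 1 / d" by (rule balance)
  also have "\<dots> \<le> - potential \<sigma> w (l - d) - (Dl + 1 / d)"
    using pot(1) by (simp add: Dl_def)
  also have "\<dots> \<le> - potential \<sigma> w (l - d) - (\<Sum>j\<in>I. interaction \<sigma> w (l - d) j) / Dl"
  proof -
    have "(\<Sum>j\<in>I. interaction \<sigma> w (l - d) j) / Dl \<le> Dl + 1 / d"
      using Dl by (simp add: pos_divide_le_eq mult.commute)
    then show ?thesis by simp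
  qed
  also have "\<dots> = (\<Sum>j\<in>I. L j)"
    by (simp add: L_def potential_def sum_negf sum_divide_distrib sum_subtractf)
  finally obtain j where j: "j \<in> I" "U j < L j" by (rule exists_less_if_sum_less)
  define t where "t = (U j + L j) / 2"
  have t: "U j < t" "t < L j" using j(2) by (auto simp: t_def)
  have U_ge: "- (x j \<bullet> ?R (u + d') (x j)) \<le> U j"
    using Du(1) interaction_nonneg by (simp add: U_def)
  have L_le: "L j \<le> - (x j \<bullet> ?R (l - d) (x j))"
    using Dl(1) interaction_nonneg by (simp add: L_def)
  have "x j \<bullet> ?R (u + d') (x j) \<le> 0"
    by (rule resolvent_nonpos_above) (rule confined_upper[OF conf'])
  then have t_pos: "0 < t" using t U_ge by linarith
  have up: "- (x j \<bullet> ?R (u + d') (x j)) < t" and low: "t < - (x j \<bullet> ?R (l - d) (x j))"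
    using t U_ge L_le by linarith+
  have j_new: "j \<notin> \<sigma>"
    using not_selected_if_resolvent_negative[OF conf' l] low t_pos by simp
  let ?\<sigma>' = "insert j \<sigma>" and ?w' = "w(j := (1 / sqrt t) *\<^sub>R x j)"
  have conf_new: "confined ?\<sigma>' ?w' (l - d) (u + d')"
    by (rule confined_insert[OF conf' l j(1) t_pos up low])
  have "potential ?\<sigma>' ?w' (l - d)
      = potential \<sigma> w (l - d) - interaction \<sigma> w (l - d) j / (t + x j \<bullet> ?R (l - d) (x j))"
    by (rule potential_insert[OF fin j_new t_pos
        gram_bounded_below.regular_value_below[OF confined_gram[OF conf' l] l order_refl]
        gram_bounded_below.regular_value_below[OF confined_gram[OF conf_new l] l order_refl]])
      (use low in simp)
  also have "\<dots> \<le> potential \<sigma> w (l - d) + Dl"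
  proof -
    define g where "g = - (t + x j \<bullet> ?R (l - d) (x j))"
    have "0 < g" using low by (simp add: g_def)
    moreover have "interaction \<sigma> w (l - d) j / Dl < g"
      using t(2) by (simp add: g_def L_def)
    ultimately have "interaction \<sigma> w (l - d) j / g \<le> Dl"
      using Dl(1) by (simp add: pos_divide_less_eq pos_divide_le_eq mult.commute)
    moreover have "t + x j \<bullet> ?R (l - d) (x j) = - g" by (simp add: g_def)
    ultimately show ?thesis by simp
  qed
  finally have pot_l: "potential ?\<sigma>' ?w' (l - d) \<le> - \<alpha>"
    using pot(1) by (simp add: Dl_def)
  have pot_eq: "potential ?\<sigma>' ?w' (u + d')
      = potential \<sigma> w (u + d') - interaction \<sigma> w (u + d') j / (t + x j \<bullet> ?R (u + d') (x j))"
    by (rule potential_insert[OF fin j_new t_pos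
        regular_value_above[OF confined_upper[OF conf']]
        regular_value_above[OF confined_upper[OF conf_new]]])
      (use up in simp_all)
  have "interaction \<sigma> w (u + d') j / (t + x j \<bullet> ?R (u + d') (x j)) \<le> Du"
  proof -
    define g where "g = t + x j \<bullet> ?R (u + d') (x j)"
    have "0 < g" using up by (simp add: g_def)
    moreover have "interaction \<sigma> w (u + d') j / Du < g"
      using t(1) by (simp add: g_def U_def)
    ultimately have "interaction \<sigma> w (u + d') j / g \<le> Du"
      using Du(1) by (simp add: pos_divide_less_eq pos_divide_le_eq mult.commute)
    then show ?thesis by (simp add: g_def)
  qed
  then have pot_u: "- \<beta> \<le> potential ?\<sigma>' ?w' (u + d')"
    using pot(2) by (simp add: pot_eq Du_def)
  show ?thesis
    by (rule that[OF _ conf_new pot_l pot_u]) (simp add: fin j_new)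
qed

text \<open>
With both barriers at rest the potentials need not be preserved, and only the criteria of
\<open>confined_insert\<close> remain. Summed over all candidates they are a comparison of the potentials.
\<close>

lemma last_step:
  assumes conf: "confined \<sigma> w l u" and l: "0 < l"
    and pot: "potential \<sigma> w l < potential \<sigma> w u"
  obtains \<sigma>' w' where "card \<sigma>' = Suc (card \<sigma>)" "confined \<sigma>' w' l u"
proof -
  let ?R = "resolvent (frame_op \<sigma> w)"
  have fin: "finite \<sigma>"
    using conf finite_index finite_subset unfolding confined_def by blast
  have "(\<Sum>j\<in>I. - (x j \<bullet> ?R u (x j))) < (\<Sum>j\<in>I. - (x j \<bullet> ?R l (x j)))"
    using pot by (simp add: potential_def sum_negf)
  then obtain j where j: "j \<in> I" "- (x j \<bullet> ?R u (x j)) < - (x j \<bullet> ?R l (x j))"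
    by (rule exists_less_if_sum_less)
  then obtain t where t: "- (x j \<bullet> ?R u (x j)) < t" "t < - (x j \<bullet> ?R l (x j))"
    using dense by blast
  have "x j \<bullet> ?R u (x j) \<le> 0"
    by (rule resolvent_nonpos_above) (rule confined_upper[OF conf])
  then have t_pos: "0 < t" using t by linarith
  have j_new: "j \<notin> \<sigma>"
    using not_selected_if_resolvent_negative[OF conf l] t t_pos by simp
  show ?thesis
    using that confined_insert[OF conf l j(1) t_pos t] fin j_new by (metis card_insert_disjoint)
qed

lemma confined_empty: "0 < u \<Longrightarrow> confined {} w l u"
  by (simp add: confined_def)

lemma potential_empty:
  assumes "c \<noteq> 0"
  shows "potential {} w c = - (energy / c)"
proof -
  interpret regular_value "frame_op {} w" c
    by (rule regular_value.intro) (use assms in \<open>auto simp: linear_frame_op frame_op_self_adjoint frame_op_def linear_zero\<close>)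
  have "resolvent (frame_op {} w) c z = - (1 / c) *\<^sub>R z" for z
    by (rule resolvent_eqI) (use assms in \<open>simp add: frame_op_def\<close>)
  then show ?thesis
    by (simp add: potential_def energy_def power2_norm_eq_inner sum_negf sum_divide_distrib)
qed

text \<open>
Both barriers start where the potentials equal \<open>- 1 / \<epsilon>\<close> and \<open>- 1 / (2 - \<epsilon>)\<close>. The step sizes
\<open>\<epsilon> / (1 - \<epsilon>)\<close> and \<open>(2 - \<epsilon>) / (1 - \<epsilon>)\<close> balance \<open>barrier_step\<close> exactly, both sides being \<open>1\<close>,
and they are such that after \<open>(1 - \<epsilon>)\<^sup>2 h\<close> steps the barriers would reach \<open>\<epsilon>\<^sup>2 h\<close> and
\<open>(2 - \<epsilon>)\<^sup>2 h\<close>, where \<open>h\<close> is the energy.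
\<close>

lemma barrier_iteration:
  assumes \<epsilon>: "0 < \<epsilon>" "\<epsilon> < 1" and energy: "0 < energy"
    and k: "real k < (1 - \<epsilon>)\<^sup>2 * energy"
  shows "\<exists>\<sigma> w. card \<sigma> = k \<and>
    confined \<sigma> w (\<epsilon> * energy - k * (\<epsilon> / (1 - \<epsilon>))) ((2 - \<epsilon>) * energy + k * ((2 - \<epsilon>) / (1 - \<epsilon>))) \<and>
    potential \<sigma> w (\<epsilon> * energy - k * (\<epsilon> / (1 - \<epsilon>))) \<le> - (1 / \<epsilon>) \<and>
    - (1 / (2 - \<epsilon>)) \<le> potential \<sigma> w ((2 - \<epsilon>) * energy + k * ((2 - \<epsilon>) / (1 - \<epsilon>)))"
  using k
proof (induction k)
  case 0
  then show ?case
    using \<epsilon> energy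
    by (intro exI[of _ "{}"] exI[of _ x] conjI confined_empty) (simp_all add: potential_empty)
next
  case (Suc k)
  define d d' l u :: real where "d = \<epsilon> / (1 - \<epsilon>)" and "d' = (2 - \<epsilon>) / (1 - \<epsilon>)"
    and "l = \<epsilon> * energy - k * d" and "u = (2 - \<epsilon>) * energy + k * d'"
  have "real k < (1 - \<epsilon>)\<^sup>2 * energy" using Suc.prems by simp
  then obtain \<sigma> w where sw: "card \<sigma> = k" "confined \<sigma> w l u"
    "potential \<sigma> w l \<le> - (1 / \<epsilon>)" "- (1 / (2 - \<epsilon>)) \<le> potential \<sigma> w u"
    using Suc.IH unfolding l_def u_def d_def d'_def by blast
  have d: "0 < d" "0 < d'" using \<epsilon> by (auto simp: d_def d'_def)
  have "real (Suc k) * d < (1 - \<epsilon>)\<^sup>2 * energy * d"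
    using Suc.prems d(1) by (rule mult_strict_right_mono)
  also have "\<dots> = (1 - \<epsilon>) * (\<epsilon> * energy)"
    using \<epsilon> by (simp add: d_def power2_eq_square)
  also have "\<dots> \<le> \<epsilon> * energy"
    using \<epsilon> energy by (intro mult_left_le_one_le) auto
  finally have dl: "d < l" by (simp add: l_def algebra_simps)
  have "\<epsilon> \<le> d" using \<epsilon> by (simp add: d_def field_simps)
  then have large: "l \<le> d * (energy - card \<sigma>)"
    using energy by (simp add: l_def sw(1) algebra_simps)
  have balance: "1 / (2 - \<epsilon>) + 1 / d' \<le> 1 / \<epsilon> - 1 / d"
  proof -
    have "1 / (2 - \<epsilon>) + 1 / d' = (1 + (1 - \<epsilon>)) / (2 - \<epsilon>)"
      unfolding add_divide_distrib by (simp add: d'_def)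
    moreover have "1 / \<epsilon> - 1 / d = 1"
      using \<epsilon> by (simp add: d_def diff_divide_distrib)
    ultimately show ?thesis using \<epsilon> by simp
  qed
  have l_next: "l - d = \<epsilon> * energy - Suc k * (\<epsilon> / (1 - \<epsilon>))"
    unfolding l_def d_def[symmetric] by (simp add: algebra_simps)
  have u_next: "u + d' = (2 - \<epsilon>) * energy + Suc k * ((2 - \<epsilon>) / (1 - \<epsilon>))"
    unfolding u_def d'_def[symmetric] by (simp add: algebra_simps)
  obtain \<sigma>' w' where "card \<sigma>' = Suc (card \<sigma>)" "confined \<sigma>' w' (l - d) (u + d')"
    "potential \<sigma>' w' (l - d) \<le> - (1 / \<epsilon>)" "- (1 / (2 - \<epsilon>)) \<le> potential \<sigma>' w' (u + d')"
    using barrier_step[OF sw(2) d(1) dl d(2) large sw(3,4) balance] .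
  then show ?case
    unfolding l_next[symmetric] u_next[symmetric] sw(1) by (intro exI conjI)
qed

text \<open>
Moving steps are made for the largest integer \<open>k\<close> strictly below \<open>(1 - \<epsilon>)\<^sup>2 h\<close>; the last
step then supplies the vector with number \<open>k + 1 \<ge> (1 - \<epsilon>)\<^sup>2 h\<close>.
\<close>

lemma confined_selection:
  assumes \<epsilon>: "0 < \<epsilon>" "\<epsilon> < 1" and energy: "0 < energy"
  obtains \<sigma> w where "(1 - \<epsilon>)\<^sup>2 * energy \<le> card \<sigma>"
    "confined \<sigma> w (\<epsilon>\<^sup>2 * energy) ((2 - \<epsilon>)\<^sup>2 * energy)"
proof -
  define c where "c = (1 - \<epsilon>)\<^sup>2 * energy"
  have "0 < c" using \<epsilon> energy by (simp add: c_def)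
  define k where "k = nat (\<lceil>c\<rceil> - 1)"
  have k: "real k < c" "c \<le> real (Suc k)"
    using \<open>0 < c\<close> unfolding k_def by linarith+
  define l u where "l = \<epsilon> * energy - k * (\<epsilon> / (1 - \<epsilon>))"
    and "u = (2 - \<epsilon>) * energy + k * ((2 - \<epsilon>) / (1 - \<epsilon>))"
  obtain \<sigma> w where sw: "card \<sigma> = k" "confined \<sigma> w l u"
    "potential \<sigma> w l \<le> - (1 / \<epsilon>)" "- (1 / (2 - \<epsilon>)) \<le> potential \<sigma> w u"
    using barrier_iteration[OF \<epsilon> energy k(1)[unfolded c_def]] unfolding l_def u_def by blast
  have c_scale: "c * (r / (1 - \<epsilon>)) = (1 - \<epsilon>) * energy * r" for r
    using \<epsilon> by (simp add: c_def power2_eq_square)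
  have "k * (\<epsilon> / (1 - \<epsilon>)) \<le> c * (\<epsilon> / (1 - \<epsilon>))"
    using k(1) \<epsilon> by (intro mult_right_mono) auto
  then have l: "\<epsilon>\<^sup>2 * energy \<le> l"
    unfolding c_scale by (simp add: l_def power2_eq_square algebra_simps)
  have "k * ((2 - \<epsilon>) / (1 - \<epsilon>)) \<le> c * ((2 - \<epsilon>) / (1 - \<epsilon>))"
    using k(1) \<epsilon> by (intro mult_right_mono) auto
  then have u: "u \<le> (2 - \<epsilon>)\<^sup>2 * energy"
    unfolding c_scale by (simp add: u_def power2_eq_square algebra_simps)
  have "0 < \<epsilon>\<^sup>2 * energy" using \<epsilon> energy by simp
  then have l_pos: "0 < l" using l by linarith
  have "1 / (2 - \<epsilon>) < 1 / \<epsilon>" using \<epsilon> by (simp add: field_simps)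
  then have "potential \<sigma> w l < potential \<sigma> w u" using sw(3,4) by linarith
  then obtain \<sigma>' w' where "card \<sigma>' = Suc (card \<sigma>)" "confined \<sigma>' w' l u"
    using last_step[OF sw(2) l_pos] by blast
  then show ?thesis
    using that[of \<sigma>' w'] confined_mono[OF _ l u] k(2) sw(1) by (simp add: c_def)
qed

section \<open>Normalising the selected vectors\<close>

lemma confined_gram_upper:
  assumes conf: "confined \<sigma> w l u" and "0 < u"
  shows "(norm (\<Sum>j\<in>\<sigma>. a j *\<^sub>R w j))\<^sup>2 \<le> u * (\<Sum>j\<in>\<sigma>. (a j)\<^sup>2)"
proof (cases "(\<Sum>j\<in>\<sigma>. a j *\<^sub>R w j) = 0")
  case True
  then show ?thesis using \<open>0 < u\<close> by (simp add: sum_nonneg)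
next
  case False
  define z where "z = (\<Sum>j\<in>\<sigma>. a j *\<^sub>R w j)"
  have "z \<noteq> 0" using False by (simp add: z_def)
  let ?N = "(norm z)\<^sup>2"
  have "?N = (\<Sum>j\<in>\<sigma>. a j * (w j \<bullet> z))"
    unfolding power2_norm_eq_inner by (subst (1) z_def) (simp add: inner_sum_left)
  then have "?N\<^sup>2 \<le> (\<Sum>j\<in>\<sigma>. (a j)\<^sup>2) * (\<Sum>j\<in>\<sigma>. (w j \<bullet> z)\<^sup>2)"
    by (simp add: Cauchy_Schwarz_ineq_sum)
  also have "\<dots> \<le> (\<Sum>j\<in>\<sigma>. (a j)\<^sup>2) * (u * ?N)"
    using confined_upper[OF conf \<open>z \<noteq> 0\<close>] by (intro mult_left_mono sum_nonneg) auto
  finally have "?N * ?N \<le> (u * (\<Sum>j\<in>\<sigma>. (a j)\<^sup>2)) * ?N"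
    by (simp add: power2_eq_square mult_ac)
  moreover have "0 < ?N" using \<open>z \<noteq> 0\<close> by simp
  ultimately have "?N \<le> u * (\<Sum>j\<in>\<sigma>. (a j)\<^sup>2)" by (rule mult_right_le_imp_le)
  then show ?thesis by (simp only: z_def)
qed

text \<open>
The squared norms are the diagonal entries of the Gram matrix.
\<close>

lemma confined_norms:
  assumes conf: "confined \<sigma> w l u" and "0 < l" "0 < u" and "j \<in> \<sigma>"
  shows "l \<le> (norm (w j))\<^sup>2" "(norm (w j))\<^sup>2 \<le> u"
proof -
  interpret gram_bounded_below \<sigma> w l by (rule confined_gram) fact+
  let ?e = "\<lambda>i. if i = j then 1 else 0 :: real"
  have e: "(\<Sum>i\<in>\<sigma>. ?e i *\<^sub>R w i) = w j" "(\<Sum>i\<in>\<sigma>. (?e i)\<^sup>2) = 1"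
  proof -
    have "(\<Sum>i\<in>\<sigma>. ?e i *\<^sub>R w i) = (\<Sum>i\<in>\<sigma>. if i = j then w i else 0)"
      "(\<Sum>i\<in>\<sigma>. (?e i)\<^sup>2) = (\<Sum>i\<in>\<sigma>. if i = j then 1 else 0)"
      by (rule sum.cong; simp)+
    then show "(\<Sum>i\<in>\<sigma>. ?e i *\<^sub>R w i) = w j" "(\<Sum>i\<in>\<sigma>. (?e i)\<^sup>2) = 1"
      using fin \<open>j \<in> \<sigma>\<close> by simp_all
  qed
  show "l \<le> (norm (w j))\<^sup>2" using gram_weak[of ?e] unfolding e by simp
  show "(norm (w j))\<^sup>2 \<le> u"
    using confined_gram_upper[OF conf \<open>0 < u\<close>, of ?e] unfolding e by simp
qed

text \<open>
Since the weights are positive, \<open>x j\<close> and \<open>w j\<close> have the same normalisation. A combination of the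
normalised vectors with coefficients \<open>a j\<close> is one of the \<open>w j\<close> with coefficients
\<open>a j / norm (w j)\<close>, so the Gram bounds apply up to the spread of the norms.
\<close>

lemma confined_normalised_bounds:
  assumes conf: "confined \<sigma> w l u" and "0 < l" "0 < u"
  defines "v \<equiv> \<lambda>j. (1 / norm (x j)) *\<^sub>R x j"
  shows "l / u * (\<Sum>j\<in>\<sigma>. (a j)\<^sup>2) \<le> (norm (\<Sum>j\<in>\<sigma>. a j *\<^sub>R v j))\<^sup>2"
    and "(norm (\<Sum>j\<in>\<sigma>. a j *\<^sub>R v j))\<^sup>2 \<le> u / l * (\<Sum>j\<in>\<sigma>. (a j)\<^sup>2)"
proof -
  interpret gram_bounded_below \<sigma> w l by (rule confined_gram) fact+
  define b where "b j = a j / norm (w j)" for j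
  have same: "a j *\<^sub>R v j = b j *\<^sub>R w j" if j: "j \<in> \<sigma>" for j
  proof -
    obtain r where r: "r > 0" "w j = r *\<^sub>R x j"
      using conf j unfolding confined_def by blast
    have "norm (w j) = r * norm (x j)" using r(1) unfolding r(2) by simp
    then have "b j * r = a j * (1 / norm (x j))" using r(1) by (simp add: b_def)
    then show ?thesis by (simp only: v_def r(2) scaleR_scaleR)
  qed
  have eq: "(\<Sum>j\<in>\<sigma>. a j *\<^sub>R v j) = (\<Sum>j\<in>\<sigma>. b j *\<^sub>R w j)"
    by (intro sum.cong refl same)
  have b: "(a j)\<^sup>2 / u \<le> (b j)\<^sup>2" "(b j)\<^sup>2 \<le> (a j)\<^sup>2 / l" if "j \<in> \<sigma>" for j
  proof -
    note n = confined_norms[OF conf \<open>0 < l\<close> \<open>0 < u\<close> that]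
    have "0 < (norm (w j))\<^sup>2" using n(1) \<open>0 < l\<close> by linarith
    then show "(a j)\<^sup>2 / u \<le> (b j)\<^sup>2" "(b j)\<^sup>2 \<le> (a j)\<^sup>2 / l"
      using frac_le[OF zero_le_power2 order_refl _ n(2), of "a j"]
        frac_le[OF zero_le_power2 order_refl \<open>0 < l\<close> n(1), of "a j"]
      by (simp_all only: b_def power_divide)
  qed
  have "l / u * (\<Sum>j\<in>\<sigma>. (a j)\<^sup>2) = l * (\<Sum>j\<in>\<sigma>. (a j)\<^sup>2 / u)"
    by (simp add: sum_divide_distrib[symmetric])
  also have "\<dots> \<le> l * (\<Sum>j\<in>\<sigma>. (b j)\<^sup>2)"
    using \<open>0 < l\<close> by (intro mult_left_mono sum_mono b) simp_all
  also have "\<dots> \<le> (norm (\<Sum>j\<in>\<sigma>. b j *\<^sub>R w j))\<^sup>2"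
    by (rule gram_weak)
  finally show "l / u * (\<Sum>j\<in>\<sigma>. (a j)\<^sup>2) \<le> (norm (\<Sum>j\<in>\<sigma>. a j *\<^sub>R v j))\<^sup>2"
    unfolding eq .
  have "(norm (\<Sum>j\<in>\<sigma>. b j *\<^sub>R w j))\<^sup>2 \<le> u * (\<Sum>j\<in>\<sigma>. (b j)\<^sup>2)"
    by (rule confined_gram_upper) fact+
  also have "\<dots> \<le> u * (\<Sum>j\<in>\<sigma>. (a j)\<^sup>2 / l)"
    using \<open>0 < u\<close> by (intro mult_left_mono sum_mono b) simp_all
  also have "\<dots> = u / l * (\<Sum>j\<in>\<sigma>. (a j)\<^sup>2)"
    by (simp add: sum_divide_distrib[symmetric])
  finally show "(norm (\<Sum>j\<in>\<sigma>. a j *\<^sub>R v j))\<^sup>2 \<le> u / l * (\<Sum>j\<in>\<sigma>. (a j)\<^sup>2)"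
    unfolding eq .
qed

end

section \<open>Decompositions of the identity\<close>

lemma outer_square_mult: "outer_square y *v z = (y \<bullet> z) *\<^sub>R y"
  by (simp add: outer_square_def vec_eq_iff matrix_vector_mult_def matrix_matrix_mult_def
      columnvector_def rowvector_def inner_vec_def sum_distrib_left mult_ac)

lemma parseval_of_identity_decomposition:
  fixes y :: "'i \<Rightarrow> real ^ 'n"
  assumes "mat 1 = (\<Sum>i\<in>S. outer_square (y i))" "finite S"
  shows "(\<Sum>i\<in>S. (y i \<bullet> z)\<^sup>2) = (norm z)\<^sup>2"
proof -
  have "(\<Sum>i\<in>S. outer_square (y i)) *v z = (\<Sum>i\<in>S. outer_square (y i) *v z)"
    using assms(2) by (induction S) (simp_all add: matrix_vector_mult_add_rdistrib)
  then have "z = (\<Sum>i\<in>S. (y i \<bullet> z) *\<^sub>R y i)"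
    by (simp add: assms(1)[symmetric] outer_square_mult)
  then have "z \<bullet> z = (\<Sum>i\<in>S. (y i \<bullet> z) *\<^sub>R y i) \<bullet> z" by simp
  then show ?thesis
    unfolding power2_norm_eq_inner by (simp add: inner_sum_left power2_eq_square)
qed

lemma norm_sq_components: "(norm (v :: real ^ 'n))\<^sup>2 = (\<Sum>k\<in>UNIV. (v $ k)\<^sup>2)"
  unfolding power2_norm_eq_inner by (simp add: inner_vec_def power2_eq_square)

text \<open>
The rows of the matrix of \<open>T\<close> are the images of the standard basis under the adjoint.
\<close>

lemma hs_norm_sq:
  assumes "linear T"
  shows "(hs_norm T)\<^sup>2 = (\<Sum>i\<in>UNIV. (norm (adjoint T (axis i 1)))\<^sup>2)"
proof -
  have "adjoint T (axis i 1) $ k = matrix T $ i $ k" for i k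
  proof -
    have "adjoint T (axis i 1) $ k = axis k 1 \<bullet> adjoint T (axis i 1)"
      by (simp add: inner_axis')
    also have "\<dots> = T (axis k 1) $ i"
      by (simp add: adjoint_works[OF assms] inner_axis)
    finally show ?thesis by (simp add: matrix_def)
  qed
  then have "trace (matrix T ** transpose (matrix T)) = (\<Sum>i\<in>UNIV. (norm (adjoint T (axis i 1)))\<^sup>2)"
    unfolding norm_sq_components
    by (simp add: trace_def matrix_matrix_mult_def transpose_def power2_eq_square)
  then show ?thesis by (simp add: hs_norm_def sum_nonneg)
qed

lemma norm_adjoint_le:
  fixes T :: "'a::euclidean_space \<Rightarrow> 'b::euclidean_space"
  assumes "linear T"
  shows "norm (adjoint T z) \<le> onorm T * norm z"
proof (cases "adjoint T z = 0")
  case True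
  then show ?thesis
    using onorm_pos_le[of T] assms by (simp add: linear_conv_bounded_linear)
next
  case False
  let ?g = "adjoint T z"
  have "norm ?g * norm ?g = T ?g \<bullet> z"
    by (simp add: adjoint_works[OF assms, symmetric] dot_square_norm power2_eq_square)
  also have "\<dots> \<le> norm (T ?g) * norm z" by (rule norm_cauchy_schwarz)
  also have "\<dots> \<le> onorm T * norm ?g * norm z"
    using onorm[of T ?g] assms by (intro mult_right_mono) (auto simp: linear_conv_bounded_linear)
  finally have "norm ?g * norm ?g \<le> (onorm T * norm z) * norm ?g" by (simp add: mult_ac)
  then show ?thesis using False by simp
qed

theorem proposition3p1:
  fixes y :: "nat \<Rightarrow> real ^ 'n"
    and m :: nat
    and T :: "real ^ 'n \<Rightarrow> real ^ 'n"
    and \<epsilon> :: real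
  assumes "mat 1 = (\<Sum>i\<in>{1..m}. outer_square (y i))"
    and "linear T"
    and "T \<noteq> (\<lambda>x. 0)"
    and "0 < \<epsilon>" and "\<epsilon> < 1"
  shows "\<exists>\<sigma>. \<sigma> \<subseteq> {1..m} \<and> (\<forall>j\<in>\<sigma>. T (y j) \<noteq> 0) \<and>
      real (card \<sigma>) \<ge> (1 - \<epsilon>)\<^sup>2 * ((hs_norm T)\<^sup>2 / (onorm T)\<^sup>2) \<and>
      (\<forall>a :: nat \<Rightarrow> real.
         \<epsilon> / (2 - \<epsilon>) * sqrt (\<Sum>j\<in>\<sigma>. (a j)\<^sup>2)
           \<le> norm (\<Sum>j\<in>\<sigma>. a j *\<^sub>R ((1 / norm (T (y j))) *\<^sub>R T (y j))) \<and>
         norm (\<Sum>j\<in>\<sigma>. a j *\<^sub>R ((1 / norm (T (y j))) *\<^sub>R T (y j)))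
           \<le> (2 - \<epsilon>) / \<epsilon> * sqrt (\<Sum>j\<in>\<sigma>. (a j)\<^sup>2))"
proof -
  define \<tau> where "\<tau> = onorm T"
  have \<tau>: "0 < \<tau>"
    using onorm_pos_lt[of T] assms(2,3) unfolding \<tau>_def by (auto simp: linear_conv_bounded_linear)
  define x where "x j = (1 / \<tau>) *\<^sub>R T (y j)" for j
  \<comment> \<open>The decomposition of the identity turns sums over \<open>j\<close> into norms of adjoint images; this
    yields both the Bessel inequality and the energy.\<close>
  have dual: "(\<Sum>j\<in>{1..m}. (T (y j) \<bullet> z)\<^sup>2) = (norm (adjoint T z))\<^sup>2" for z
    using parseval_of_identity_decomposition[OF assms(1), of "adjoint T z"]
    by (simp add: adjoint_works[OF assms(2)])
  interpret bessel_family "{1..m}" x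
  proof
    show "(\<Sum>j\<in>{1..m}. (x j \<bullet> z)\<^sup>2) \<le> (norm z)\<^sup>2" for z
    proof -
      have "(\<Sum>j\<in>{1..m}. (x j \<bullet> z)\<^sup>2) = (norm (adjoint T z))\<^sup>2 / \<tau>\<^sup>2"
        unfolding dual[symmetric] by (simp add: x_def power_divide sum_divide_distrib)
      also have "\<dots> \<le> (\<tau> * norm z)\<^sup>2 / \<tau>\<^sup>2"
        using norm_adjoint_le[OF assms(2), of z] unfolding \<tau>_def
        by (intro divide_right_mono power_mono) auto
      finally show ?thesis using \<tau> by (simp add: power_mult_distrib)
    qed
  qed simp
  have "(\<Sum>j\<in>{1..m}. (norm (T (y j)))\<^sup>2) = (\<Sum>j\<in>{1..m}. \<Sum>i\<in>UNIV. (T (y j) \<bullet> axis i 1)\<^sup>2)"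
    by (simp add: norm_sq_components inner_axis)
  also have "\<dots> = (\<Sum>i\<in>UNIV. \<Sum>j\<in>{1..m}. (T (y j) \<bullet> axis i 1)\<^sup>2)" by (rule sum.swap)
  also have "\<dots> = (hs_norm T)\<^sup>2" by (simp only: dual hs_norm_sq[OF assms(2)])
  finally have energy_eq: "energy = (hs_norm T)\<^sup>2 / \<tau>\<^sup>2"
    unfolding energy_def by (simp add: x_def power_divide sum_divide_distrib[symmetric])
  have "0 < (hs_norm T)\<^sup>2"
  proof (rule ccontr)
    assume "\<not> 0 < (hs_norm T)\<^sup>2"
    then have "(hs_norm T)\<^sup>2 = 0" by simp
    then have "(\<Sum>i\<in>UNIV. (norm (adjoint T (axis i 1)))\<^sup>2) = 0"
      by (simp only: hs_norm_sq[OF assms(2)])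
    then have zero: "adjoint T (axis i 1) = 0" for i
      by (simp add: sum_nonneg_eq_0_iff)
    have "T z $ i = z \<bullet> adjoint T (axis i 1)" for z i
      by (simp add: adjoint_works[OF assms(2)] inner_axis)
    then have "T = (\<lambda>x. 0)" by (simp add: zero vec_eq_iff fun_eq_iff)
    with assms(3) show False by contradiction
  qed
  then have energy: "0 < energy" unfolding energy_eq using \<tau> by simp
  obtain \<sigma> w where sw: "(1 - \<epsilon>)\<^sup>2 * energy \<le> card \<sigma>"
    "confined \<sigma> w (\<epsilon>\<^sup>2 * energy) ((2 - \<epsilon>)\<^sup>2 * energy)"
    using confined_selection[OF assms(4,5) energy] by blast
  have l: "0 < \<epsilon>\<^sup>2 * energy" and u: "0 < (2 - \<epsilon>)\<^sup>2 * energy"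
    using assms(4,5) energy by auto
  have normalised: "(1 / norm (x j)) *\<^sub>R x j = (1 / norm (T (y j))) *\<^sub>R T (y j)" for j
    using \<tau> by (simp add: x_def)
  have nonzero: "T (y j) \<noteq> 0" if j: "j \<in> \<sigma>" for j
  proof -
    obtain r where "w j = r *\<^sub>R x j" using sw(2) j unfolding confined_def by blast
    then show ?thesis using confined_norms(1)[OF sw(2) l u j] l by (auto simp: x_def)
  qed
  have subset: "\<sigma> \<subseteq> {1..m}" using sw(2) unfolding confined_def by blast
  have bounds: "\<epsilon> / (2 - \<epsilon>) * sqrt (\<Sum>j\<in>\<sigma>. (a j)\<^sup>2)
       \<le> norm (\<Sum>j\<in>\<sigma>. a j *\<^sub>R ((1 / norm (T (y j))) *\<^sub>R T (y j)))" (is "?l \<le> ?N")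
    and bounds': "norm (\<Sum>j\<in>\<sigma>. a j *\<^sub>R ((1 / norm (T (y j))) *\<^sub>R T (y j)))
       \<le> (2 - \<epsilon>) / \<epsilon> * sqrt (\<Sum>j\<in>\<sigma>. (a j)\<^sup>2)" (is "_ \<le> ?u") for a
  proof -
    have s: "0 \<le> (\<Sum>j\<in>\<sigma>. (a j)\<^sup>2)" by (simp add: sum_nonneg)
    have "?l\<^sup>2 \<le> ?N\<^sup>2" "?N\<^sup>2 \<le> ?u\<^sup>2"
      using confined_normalised_bounds[OF sw(2) l u, of a] energy s
      unfolding normalised by (simp_all add: power_mult_distrib power_divide)
    then show "?l \<le> ?N" "?N \<le> ?u"
      using assms(4,5) s by (auto intro: power2_le_imp_le)
  qed
  show ?thesis
    by (intro exI[of _ \<sigma>] conjI allI ballI subset nonzero bounds bounds'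
      sw(1)[unfolded energy_eq \<tau>_def])
qed

end
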